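(* Suppose $f_1,\ldots,f_m$ are convex and let $(x_t)_{0\leq t\leq T}$ be the iterates of AdaSFW run with batch-sizes $b_t=\left\lceil\left(\frac{G(t+2)}{LD}\right)^2\right\rceil$, learning rates $\eta_t=\lambda_t^-/L$, and step-size bounds $\gamma_t=\frac{2}{t+2}$. Let $\kappa=\lambda_0^+/\lambda_0^-$. Then for all $t\in\{1,\ldots,T\}$, $$\mathsf{E}[f(x_t)]-\min_{\mathcal{C}}f\leq\frac{2LD^2(K+1+\kappa)}{t+1}.$$
   Context: Problem. $\mathcal{C}\subset\mathbb{R}^n$ is a (nonempty) compact convex set, $f_1,\ldots,f_m\colon\mathbb{R}^n\to\mathbb{R}$ are smooth functions (differentiable with Lipschitz gradient), and $f=\frac1m\sum_{i=1}^m f_i$. Let $D=\max_{x,y\in\mathcal{C}}\|y-x\|_2$, $G=\max_{1\leq i\leq m}\max_{x\in\mathcal{C}}\|\nabla f_i(x)\|_2$, and $L=\max_{1\leq i\leq m}\sup_{x,y\in\mathcal{C},x\neq y}\|\nabla f_i(y)-\nabla f_i(x)\|_2/\|y-x\|_2$; assume $D,G,L>0$. For a symmetric positive definite matrix $H$, $\|x\|_H=\sqrt{\langle x,Hx\rangle}$. AdaSFW. Inputs: $T\geq1$, a (deterministic) start point $x_0\in\mathcal{C}$, batch-sizes $b_t\in\mathbb{N}\setminus\{0\}$, bounds $0<\lambda_t^-\leq\lambda_{t+1}^-\leq\lambda_{t+1}^+\leq\lambda_t^+$ for all $t$, a number of inner iterations $K\in\mathbb{N}\setminus\{0\}$, learning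 rates $\eta_t>0$, step-size bounds $\gamma_t\in[0,1]$. For $t=0,\ldots,T-1$: 1. Sample $i_1,\ldots,i_{b_t}$ i.i.d. uniformly from $\{1,\ldots,m\}$, independently of the past, and set $\tilde\nabla f(x_t)=\frac{1}{b_t}\sum_{j=1}^{b_t}\nabla f_{i_j}(x_t)$. 2. Choose any diagonal matrix $H_t\in\mathbb{R}^{n\times n}$ with all diagonal entries in $[\lambda_t^-,\lambda_t^+]$ (it may depend on all information available up to and including step 1 of iteration $t$). 3. Let $Q_t(x)=f(x_t)+\langle\tilde\nabla f(x_t),x-x_t\rangle+\frac{1}{2\eta_t}\|x-x_t\|_{H_t}^2$, so $\nabla Q_t(y)=\tilde\nabla f(x_t)+\frac{1}{\eta_t}H_t(y-x_t)$. Set $y_0^{(t)}=x_t$ and, for $k=0,\ldots,K-1$: choose $v_k^{(t)}\in\arg\min_{v\in\mathcal{C}}\langle\nabla Q_t(y_k^{(t)}),v\rangle$; set $\gamma_k^{(t)}=\min\left\{\eta_t\frac{\langle\nabla Q_t(y_k^{(t)}),y_k^{(t)}-v_k^{(t)}\rangle}{\|y_k^{(t)}-v_k^{(t)}\|_{H_t}^2},\gamma_t\right\}$ (with $\gamma_k^{(t)}=0$ if $v_k^{(t)}=y_k^{(t)}$); set $y_{k+1}^{(t)}=y_k^{(t)}+\gamma_k^{(t)}(v_k^{(t)}-y_k^{(t)})$. 4. Set $x_{t+1}=y_K^{(t)}$. All choices (of $H_t$ and of minimizers) are measurable functions of the history; $\mathsf{E}$ is the expectation over all the randomness in the algorithm.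 *)

theory Defs
  imports "HOL-Probability.Probability"
begin

definition grad :: "('a::real_inner \<Rightarrow> real) \<Rightarrow> 'a \<Rightarrow> 'a" where
  "grad g x = (THE d. GDERIV g x :> d)"

definition smooth_fun :: "('a::real_inner \<Rightarrow> real) \<Rightarrow> bool" where
  "smooth_fun g \<longleftrightarrow>
     (\<forall>x. \<exists>d. GDERIV g x :> d) \<and> (\<exists>B. lipschitz_on B UNIV (grad g))"

lemma grad_eqI:
  assumes "GDERIV g x :> d"
  shows "grad g x = d"
  unfolding grad_def
proof (rule the_equality)
  show "GDERIV g x :> d" by (rule assms)
next
  fix e assume "GDERIV g x :> e"
  then have "(\<lambda>h. inner h e) = (\<lambda>h. inner h d)"
    using assms has_derivative_unique unfolding gderiv_def by blast
  then show "e = d"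
    by (metis inner_commute vector_eq_ldot)
qed

text \<open>
  The summands are \<open>f 1, \<dots>, f m\<close>. The suprema below range over nonempty bounded sets
  whenever \<open>1 \<le> m\<close>, \<open>C\<close> is compact with at least two points and the \<open>f i\<close> are smooth.
\<close>

definition avg_fun :: "nat \<Rightarrow> (nat \<Rightarrow> 'a \<Rightarrow> real) \<Rightarrow> 'a \<Rightarrow> real" where
  "avg_fun m f x = (1 / real m) * (\<Sum>i\<in>{1..m}. f i x)"

definition grad_bound ::
    "nat \<Rightarrow> (nat \<Rightarrow> 'a::real_inner \<Rightarrow> real) \<Rightarrow> 'a set \<Rightarrow> real" where
  "grad_bound m f C = (MAX i\<in>{1..m}. SUP x\<in>C. norm (grad (f i) x))"

definition smooth_const ::
    "nat \<Rightarrow> (nat \<Rightarrow> 'a::real_inner \<Rightarrow> real) \<Rightarrow> 'a set \<Rightarrow> real" where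
  "smooth_const m f C =
     (MAX i\<in>{1..m}. SUP (x, y)\<in>{(x, y). x \<in> C \<and> y \<in> C \<and> x \<noteq> y}.
        norm (grad (f i) y - grad (f i) x) / norm (y - x))"

definition diag_matrix_in :: "real \<Rightarrow> real \<Rightarrow> real ^ 'n ^ 'n \<Rightarrow> bool" where
  "diag_matrix_in l u A \<longleftrightarrow>
     (\<forall>i j. i \<noteq> j \<longrightarrow> A $ i $ j = 0) \<and> (\<forall>i. l \<le> A $ i $ i \<and> A $ i $ i \<le> u)"

definition mat_norm :: "real ^ 'n ^ 'n \<Rightarrow> real ^ 'n \<Rightarrow> real" where
  "mat_norm A x = sqrt (x \<bullet> (A *v x))"

definition quad_model ::
    "real \<Rightarrow> real ^ 'n \<Rightarrow> real \<Rightarrow> real ^ 'n ^ 'n \<Rightarrow> real ^ 'n \<Rightarrow> real ^ 'n \<Rightarrow> real" where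
  "quad_model c g \<eta> A z x =
     c + g \<bullet> (x - z) + (1 / (2 * \<eta>)) * (mat_norm A (x - z))\<^sup>2"

lemma diag_mult_vec:
  assumes "diag_matrix_in l u A"
  shows "(A *v x) $ i = A $ i $ i * x $ i"
proof -
  have off: "A $ i $ j = 0" if "j \<noteq> i" for j
    using assms that unfolding diag_matrix_in_def by metis
  have "(A *v x) $ i = (\<Sum>j\<in>UNIV. A $ i $ j * x $ j)"
    by (simp add: matrix_vector_mult_def)
  also have "\<dots> = (\<Sum>j\<in>UNIV. if j = i then A $ i $ i * x $ i else 0)"
    by (rule sum.cong) (use off in auto)
  finally show ?thesis by simp
qed

lemma grad_quad_model:
  assumes A: "diag_matrix_in l u A" and l: "0 \<le> l"
  shows "grad (quad_model c g \<eta> A z) y = g + (1 / \<eta>) *\<^sub>R (A *v (y - z))"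
proof (rule grad_eqI)
  have sym: "v \<bullet> (A *v w) = w \<bullet> (A *v v)" for v w
    unfolding inner_vec_def by (simp add: diag_mult_vec[OF A] algebra_simps)
  have diag_nonneg: "0 \<le> A $ i $ i" for i
    using A l unfolding diag_matrix_in_def by (meson order_trans)
  have nonneg: "0 \<le> v \<bullet> (A *v v)" for v
  proof -
    have "v \<bullet> (A *v v) = (\<Sum>i\<in>UNIV. A $ i $ i * (v $ i)\<^sup>2)"
      unfolding inner_vec_def diag_mult_vec[OF A] by (simp add: power2_eq_square mult_ac)
    also have "\<dots> \<ge> 0"
      by (intro sum_nonneg mult_nonneg_nonneg diag_nonneg zero_le_power2)
    finally show ?thesis .
  qed
  have eq: "quad_model c g \<eta> A z = (\<lambda>x. c + g \<bullet> (x - z) + (1 / (2 * \<eta>)) * ((x - z) \<bullet> (A *v (x - z))))"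
    unfolding quad_model_def mat_norm_def using nonneg by (auto simp: fun_eq_iff)
  have sub: "((\<lambda>x. x - z) has_derivative (\<lambda>h. h)) (at y)"
    by (auto intro!: derivative_eq_intros)
  have mul: "((\<lambda>x. A *v (x - z)) has_derivative (\<lambda>h. A *v h)) (at y)"
    by (rule bounded_linear.has_derivative[OF matrix_vector_mul_bounded_linear sub])
  have "(quad_model c g \<eta> A z has_derivative
      (\<lambda>h. 0 + g \<bullet> h + (1 / (2 * \<eta>)) * ((y - z) \<bullet> (A *v h) + h \<bullet> (A *v (y - z))))) (at y)"
    unfolding eq
    by (intro has_derivative_add has_derivative_const has_derivative_inner_right
        has_derivative_mult_right has_derivative_inner sub mul)
  moreover have "(\<lambda>h. 0 + g \<bullet> h + (1 / (2 * \<eta>)) * ((y - z) \<bullet> (A *v h) + h \<bullet> (A *v (y - z))))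
      = (\<lambda>h. h \<bullet> (g + (1 / \<eta>) *\<^sub>R (A *v (y - z))))"
    unfolding sym[of "y - z"]
    by (auto simp: fun_eq_iff inner_add_right inner_commute[of g])
  ultimately show "GDERIV (quad_model c g \<eta> A z) y :> g + (1 / \<eta>) *\<^sub>R (A *v (y - z))"
    unfolding gderiv_def by simp
qed

text \<open>
  \<open>past t\<close> is the information available when iteration \<open>t\<close> starts, and \<open>mid t\<close> the information
  available after its sampling step, so that \<open>H t\<close> may depend on the samples of iteration \<open>t\<close>.
  Allowing arbitrary \<open>\<sigma>\<close>-algebras, rather than only those generated by the samples,
  also covers choices which use additional randomness.

  \<open>I t j\<close> is the \<open>j\<close>-th index sampled in iteration \<open>t\<close>, and \<open>y t k\<close>, \<open>v t k\<close> are the inner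
  iterates and the Frank--Wolfe vertices.
\<close>

definition batch_grad ::
    "(nat \<Rightarrow> real ^ 'n \<Rightarrow> real) \<Rightarrow> nat \<Rightarrow> (nat \<Rightarrow> nat) \<Rightarrow> real ^ 'n \<Rightarrow> real ^ 'n" where
  "batch_grad f b s x = (1 / real b) *\<^sub>R (\<Sum>j\<in>{1..b}. grad (f (s j)) x)"

locale AdaSFW = prob_space M
  for M :: "'w measure" +
  fixes C :: "(real ^ 'n) set"
    and m :: nat
    and f :: "nat \<Rightarrow> real ^ 'n \<Rightarrow> real"
    and T K :: nat
    and x0 :: "real ^ 'n"
    and b :: "nat \<Rightarrow> nat"
    and lm lp \<eta> \<gamma> :: "nat \<Rightarrow> real"
    and past mid :: "nat \<Rightarrow> 'w measure"
    and I :: "nat \<Rightarrow> nat \<Rightarrow> 'w \<Rightarrow> nat"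
    and H :: "nat \<Rightarrow> 'w \<Rightarrow> real ^ 'n ^ 'n"
    and x :: "nat \<Rightarrow> 'w \<Rightarrow> real ^ 'n"
    and y v :: "nat \<Rightarrow> nat \<Rightarrow> 'w \<Rightarrow> real ^ 'n"
  assumes C_problem: "compact C" "convex C" "C \<noteq> {}"
    and m_pos: "1 \<le> m"
    and f_smooth: "\<And>i. i \<in> {1..m} \<Longrightarrow> smooth_fun (f i)"
    and T_pos: "1 \<le> T"
    and K_pos: "1 \<le> K"
    and x0_in: "x0 \<in> C"
    and b_pos: "\<And>t. 1 \<le> b t"
    and bounds: "\<And>t. 0 < lm t" "\<And>t. lm t \<le> lm (Suc t)"
      "\<And>t. lm (Suc t) \<le> lp (Suc t)" "\<And>t. lp (Suc t) \<le> lp t"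
    and eta_pos: "\<And>t. 0 < \<eta> t"
    and gamma_range: "\<And>t. \<gamma> t \<in> {0..1}"
    and history:
      "\<And>t. t \<le> T \<Longrightarrow> subalgebra M (past t)"
      "\<And>t. t < T \<Longrightarrow> subalgebra M (mid t)"
      "\<And>t. t < T \<Longrightarrow> subalgebra (mid t) (past t)"
      "\<And>t. t < T \<Longrightarrow> subalgebra (past (Suc t)) (mid t)"
    and sample_known:
      "\<And>t j. t < T \<Longrightarrow> j \<in> {1..b t} \<Longrightarrow> I t j \<in> measurable (mid t) (count_space {1..m})"
    and sample_uniform:
      "\<And>t j. t < T \<Longrightarrow> j \<in> {1..b t} \<Longrightarrow>
         distr M (count_space {1..m}) (I t j) = uniform_count_measure {1..m}"
    and sample_indep:
      "\<And>t. t < T \<Longrightarrow> indep_vars (\<lambda>_. count_space {1..m}) (I t) {1..b t}"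
    and sample_indep_past:
      "\<And>t. t < T \<Longrightarrow> indep_set (sets (past t))
         (sets (vimage_algebra (space M) (\<lambda>\<omega>. \<lambda>j\<in>{1..b t}. I t j \<omega>)
           (PiM {1..b t} (\<lambda>_. count_space {1..m}))))"
    and H_known: "\<And>t. t < T \<Longrightarrow> H t \<in> borel_measurable (mid t)"
    and H_diag: "\<And>t \<omega>. t < T \<Longrightarrow> \<omega> \<in> space M \<Longrightarrow> diag_matrix_in (lm t) (lp t) (H t \<omega>)"
    and y_init: "\<And>t \<omega>. t < T \<Longrightarrow> \<omega> \<in> space M \<Longrightarrow> y t 0 \<omega> = x t \<omega>"
    and v_known: "\<And>t k. t < T \<Longrightarrow> k < K \<Longrightarrow> v t k \<in> borel_measurable (past (Suc t))"
    and v_choice: "\<And>t k \<omega>. t < T \<Longrightarrow> k < K \<Longrightarrow> \<omega> \<in> space M \<Longrightarrow>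
      is_arg_min
        (\<lambda>u. grad (quad_model (avg_fun m f (x t \<omega>))
                     (batch_grad f (b t) (\<lambda>j. I t j \<omega>) (x t \<omega>)) (\<eta> t) (H t \<omega>) (x t \<omega>))
               (y t k \<omega>) \<bullet> u)
        (\<lambda>u. u \<in> C) (v t k \<omega>)"
    and y_step: "\<And>t k \<omega>. t < T \<Longrightarrow> k < K \<Longrightarrow> \<omega> \<in> space M \<Longrightarrow>
      y t (Suc k) \<omega> = y t k \<omega> +
        (if v t k \<omega> = y t k \<omega> then 0
         else min (\<eta> t *
                (grad (quad_model (avg_fun m f (x t \<omega>))
                        (batch_grad f (b t) (\<lambda>j. I t j \<omega>) (x t \<omega>)) (\<eta> t) (H t \<omega>) (x t \<omega>))
                   (y t k \<omega>) \<bullet> (y t k \<omega> - v t k \<omega>))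
                / (mat_norm (H t \<omega>) (y t k \<omega> - v t k \<omega>))\<^sup>2) (\<gamma> t))
        *\<^sub>R (v t k \<omega> - y t k \<omega>)"
    and x_init: "\<And>\<omega>. \<omega> \<in> space M \<Longrightarrow> x 0 \<omega> = x0"
    and x_step: "\<And>t \<omega>. t < T \<Longrightarrow> \<omega> \<in> space M \<Longrightarrow> x (Suc t) \<omega> = y t K \<omega>"

end

theory Submission
  imports Defs
begin

text \<open>
  With \<open>\<eta> t = lm t / L\<close> the quadratic model with the exact gradient majorises the objective, so
  \<open>f(x\<^sub>t\<^sub>+\<^sub>1)\<close> exceeds the model value at \<open>x\<^sub>t\<^sub>+\<^sub>1\<close> by at most the gradient error times
  \<open>\<parallel>x\<^sub>t\<^sub>+\<^sub>1 - x\<^sub>t\<parallel> \<le> K \<gamma>\<^sub>t D\<close>. The inner steps never increase the model, and already the first of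
  them gains what a plain Frank--Wolfe step of length \<open>\<gamma>\<^sub>t\<close> would. The batch sizes make the expected
  gradient error at most \<open>L D / (t + 2) = \<gamma>\<^sub>t L D / 2\<close>, so the expected gaps satisfy
  \<open>\<epsilon>\<^sub>t\<^sub>+\<^sub>1 \<le> (1 - \<gamma>\<^sub>t) \<epsilon>\<^sub>t + \<gamma>\<^sub>t\<^sup>2 L D\<^sup>2 (K + 1 + \<kappa>) / 2\<close>, which gives the rate by induction.
\<close>

section \<open>Gradients and smoothness\<close>

lemma smooth_fun_GDERIV: "smooth_fun g \<Longrightarrow> GDERIV g z :> grad g z"
  using grad_eqI unfolding smooth_fun_def by metis

lemma continuous_on_grad: "smooth_fun g \<Longrightarrow> continuous_on S (grad g)"
  unfolding smooth_fun_def using lipschitz_on_continuous_on continuous_on_subset by blast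

lemma continuous_on_smooth_fun: "smooth_fun g \<Longrightarrow> continuous_on S g"
  using smooth_fun_GDERIV has_derivative_continuous unfolding gderiv_def
  by (metis continuous_at_imp_continuous_on)

text \<open>Turns questions about \<open>g\<close> on a segment into calculus of one real variable;
  the tangent inequality and the descent lemma both go through it.\<close>

lemma GDERIV_line:
  fixes g :: "'a::real_inner \<Rightarrow> real"
  assumes "\<And>z. GDERIV g z :> F z"
  shows "((\<lambda>s. g (p + s *\<^sub>R d)) has_real_derivative F (p + s *\<^sub>R d) \<bullet> d) (at s within S)"
proof -
  have "((\<lambda>s. p + s *\<^sub>R d) has_derivative (\<lambda>h. h *\<^sub>R d)) (at s within S)"
    by (auto intro!: derivative_eq_intros)
  then have "((\<lambda>s. g (p + s *\<^sub>R d)) has_derivative (\<lambda>h. (h *\<^sub>R d) \<bullet> F (p + s *\<^sub>R d))) (at s within S)"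
    using assms[of "p + s *\<^sub>R d"] unfolding gderiv_def by (rule has_derivative_compose)
  then show ?thesis
    unfolding has_field_derivative_def by (simp add: inner_commute mult_commute_abs)
qed

text \<open>Restricted to the line through \<open>p\<close> and \<open>q\<close>, \<open>g\<close>
  is a convex function of one parameter; its tangent at parameter 0, compared with its value at 1,
  gives the claim.\<close>

lemma convex_on_above_tangent_GDERIV:
  fixes g :: "'a::real_inner \<Rightarrow> real"
  assumes cvx: "convex_on UNIV g" and g': "\<And>z. GDERIV g z :> F z"
  shows "g q \<ge> g p + F p \<bullet> (q - p)"
proof -
  define \<phi> where "\<phi> s = g (p + s *\<^sub>R (q - p))" for s
  have "convex_on UNIV \<phi>"
  proof (rule convex_onI)
    fix t r s :: real assume "0 < t" "t < 1"
    have "p + ((1 - t) *\<^sub>R r + t *\<^sub>R s) *\<^sub>R (q - p)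
        = (1 - t) *\<^sub>R (p + r *\<^sub>R (q - p)) + t *\<^sub>R (p + s *\<^sub>R (q - p))"
      by (simp add: algebra_simps)
    then show "\<phi> ((1 - t) *\<^sub>R r + t *\<^sub>R s) \<le> (1 - t) * \<phi> r + t * \<phi> s"
      unfolding \<phi>_def using convex_onD[OF cvx, of t] \<open>0 < t\<close> \<open>t < 1\<close> by simp
  qed simp
  moreover have "(\<phi> has_real_derivative F p \<bullet> (q - p)) (at 0)"
    using GDERIV_line[OF g', of p "q - p" 0] unfolding \<phi>_def by simp
  ultimately have "\<phi> 1 - \<phi> 0 \<ge> F p \<bullet> (q - p) * (1 - 0)"
    by (intro convex_on_imp_above_tangent[where A = UNIV]) auto
  then show ?thesis by (simp add: \<phi>_def)
qed

text \<open>Along the segment, \<open>\<phi>\<close> is \<open>g\<close> minus the claimed upper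
  bound, up to a constant. Cauchy-Schwarz and the Lipschitz estimate make its derivative
  nonpositive, so monotonicity replaces an integral remainder. The estimate is required on
  \<open>C\<close> only, because \<open>smooth_const\<close> is a supremum over \<open>C\<close>;
  convexity keeps the segment inside.\<close>

lemma descent_lemma:
  fixes g :: "'a::real_inner \<Rightarrow> real"
  assumes "convex C" and g': "\<And>z. GDERIV g z :> F z"
    and lip: "\<And>p q. p \<in> C \<Longrightarrow> q \<in> C \<Longrightarrow> norm (F q - F p) \<le> L * norm (q - p)"
    and pq: "p \<in> C" "q \<in> C"
  shows "g q \<le> g p + F p \<bullet> (q - p) + L / 2 * (norm (q - p))\<^sup>2"
proof -
  define d where "d = q - p"
  define \<phi> where "\<phi> s = g (p + s *\<^sub>R d) - s * (F p \<bullet> d) - L / 2 * s\<^sup>2 * (norm d)\<^sup>2" for s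
  have "\<phi> 1 \<le> \<phi> 0"
  proof (rule DERIV_nonpos_imp_nonincreasing[where f = \<phi>])
    fix s :: real assume s: "0 \<le> s" "s \<le> 1"
    have in_C: "p + s *\<^sub>R d \<in> C"
      using convexD_alt[OF \<open>convex C\<close> pq s] by (simp add: d_def algebra_simps)
    have "(F (p + s *\<^sub>R d) - F p) \<bullet> d \<le> norm (F (p + s *\<^sub>R d) - F p) * norm d"
      by (rule norm_cauchy_schwarz)
    also have "\<dots> \<le> L * norm (s *\<^sub>R d) * norm d"
      using lip[OF pq(1) in_C] by (intro mult_right_mono) auto
    also have "\<dots> = L * s * (norm d)\<^sup>2"
      using s by (simp add: power2_eq_square)
    finally have "F (p + s *\<^sub>R d) \<bullet> d - F p \<bullet> d - L * s * (norm d)\<^sup>2 \<le> 0"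
      by (simp add: inner_diff_left)
    moreover have "(\<phi> has_real_derivative F (p + s *\<^sub>R d) \<bullet> d - F p \<bullet> d - L * s * (norm d)\<^sup>2) (at s)"
      unfolding \<phi>_def
      by (rule derivative_eq_intros GDERIV_line[OF g'] refl)+ simp
    ultimately show "\<exists>l. (\<phi> has_real_derivative l) (at s) \<and> l \<le> 0"
      by blast
  qed simp
  then show ?thesis by (simp add: \<phi>_def d_def)
qed

section \<open>The averaged objective and the constants \<open>grad_bound\<close> and
  \<open>smooth_const\<close>\<close>

lemma GDERIV_avg_fun:
  assumes "\<And>i. i \<in> {1..m} \<Longrightarrow> smooth_fun (f i)"
  shows "GDERIV (avg_fun m f) z :> (1 / real m) *\<^sub>R (\<Sum>i\<in>{1..m}. grad (f i) z)"
proof -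
  have "(f i has_derivative (\<lambda>h. h \<bullet> grad (f i) z)) (at z)" if "i \<in> {1..m}" for i
    using smooth_fun_GDERIV[OF assms[OF that]] unfolding gderiv_def .
  then have "((\<lambda>z. (1 / real m) * (\<Sum>i\<in>{1..m}. f i z)) has_derivative
      (\<lambda>h. (1 / real m) * (\<Sum>i\<in>{1..m}. h \<bullet> grad (f i) z))) (at z)"
    by (intro has_derivative_mult_right has_derivative_sum)
  then show ?thesis
    unfolding gderiv_def avg_fun_def[abs_def] by (simp add: inner_sum_right)
qed

text \<open>A real \<open>SUP\<close> dominates its members only when they are bounded above;
  compactness of \<open>C\<close> and continuity of the gradient provide that.\<close>

lemma norm_grad_le_grad_bound:
  assumes "compact C" "smooth_fun (f i)" "i \<in> {1..m}" "z \<in> C"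
  shows "norm (grad (f i) z) \<le> grad_bound m f C"
proof -
  have "compact ((\<lambda>z. norm (grad (f i) z)) ` C)"
    using assms by (intro compact_continuous_image continuous_on_norm continuous_on_grad)
  then have "norm (grad (f i) z) \<le> (SUP x\<in>C. norm (grad (f i) x))"
    using assms by (intro cSUP_upper bounded_imp_bdd_above compact_imp_bounded)
  also have "\<dots> \<le> grad_bound m f C"
    unfolding grad_bound_def using assms by (intro Max_ge) auto
  finally show ?thesis .
qed

text \<open>The global Lipschitz constant \<open>B\<close> only bounds the difference quotients
  above, so that the supremum over \<open>C\<close> dominates each of them.\<close>

lemma norm_grad_diff_le_smooth_const:
  assumes sm: "smooth_fun (f i)" and i: "i \<in> {1..m}" and pq: "p \<in> C" "q \<in> C"
  shows "norm (grad (f i) q - grad (f i) p) \<le> smooth_const m f C * norm (q - p)"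
proof (cases "p = q")
  case False
  let ?S = "{(x, y). x \<in> C \<and> y \<in> C \<and> x \<noteq> y}"
  let ?r = "\<lambda>(x, y). norm (grad (f i) y - grad (f i) x) / norm (y - x)"
  obtain B where B: "lipschitz_on B UNIV (grad (f i))"
    using sm unfolding smooth_fun_def by blast
  have "bdd_above (?r ` ?S)"
  proof (rule bdd_aboveI)
    fix r assume "r \<in> ?r ` ?S"
    then obtain x y where "x \<noteq> y" "r = norm (grad (f i) y - grad (f i) x) / norm (y - x)"
      by auto
    with lipschitz_onD[OF B, of y x] show "r \<le> B"
      by (simp add: dist_norm divide_le_eq)
  qed
  then have "?r (p, q) \<le> (SUP z\<in>?S. ?r z)"
    using pq False by (intro cSUP_upper) auto
  also have "\<dots> \<le> smooth_const m f C"
    unfolding smooth_const_def using i by (intro Max_ge) auto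
  finally show ?thesis
    using False by (simp add: divide_le_eq)
qed simp

lemma norm_average_le:
  fixes w :: "nat \<Rightarrow> 'a::real_normed_vector"
  assumes "1 \<le> m" "\<And>i. i \<in> {1..m} \<Longrightarrow> norm (w i) \<le> B"
  shows "norm ((1 / real m) *\<^sub>R (\<Sum>i\<in>{1..m}. w i)) \<le> B"
proof -
  have "norm (\<Sum>i\<in>{1..m}. w i) \<le> (\<Sum>i\<in>{1..m}. B)"
    by (intro sum_norm_le assms)
  then show ?thesis
    using assms(1) by (simp add: divide_le_eq mult.commute)
qed

section \<open>The inner Frank--Wolfe loop\<close>

lemma diag_quadratic_form_bounds:
  assumes A: "diag_matrix_in l u A"
  shows "l * (norm w)\<^sup>2 \<le> w \<bullet> (A *v w)" "w \<bullet> (A *v w) \<le> u * (norm w)\<^sup>2"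
proof -
  have 1: "w \<bullet> (A *v w) = (\<Sum>i\<in>UNIV. A $ i $ i * (w $ i)\<^sup>2)"
    unfolding inner_vec_def diag_mult_vec[OF A] by (simp add: power2_eq_square mult_ac)
  have 2: "c * (norm w)\<^sup>2 = (\<Sum>i\<in>UNIV. c * (w $ i)\<^sup>2)" for c
    unfolding power2_norm_eq_inner inner_vec_def sum_distrib_left
    by (simp add: power2_eq_square)
  show "l * (norm w)\<^sup>2 \<le> w \<bullet> (A *v w)" "w \<bullet> (A *v w) \<le> u * (norm w)\<^sup>2"
    unfolding 1 2 using A unfolding diag_matrix_in_def by (auto intro!: sum_mono mult_right_mono)
qed

lemma mat_norm_sq:
  assumes A: "diag_matrix_in l u A" and "0 \<le> l"
  shows "(mat_norm A w)\<^sup>2 = w \<bullet> (A *v w)"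
proof -
  have "0 \<le> l * (norm w)\<^sup>2" using assms by simp
  then show ?thesis
    unfolding mat_norm_def using diag_quadratic_form_bounds(1)[OF A, of w] by simp
qed

lemma mat_norm_sq_bounds:
  assumes "diag_matrix_in l u A" and "0 \<le> l"
  shows "l * (norm w)\<^sup>2 \<le> (mat_norm A w)\<^sup>2" "(mat_norm A w)\<^sup>2 \<le> u * (norm w)\<^sup>2"
  using diag_quadratic_form_bounds[OF assms(1)] unfolding mat_norm_sq[OF assms] by auto

text \<open>The model is quadratic, so its second-order Taylor expansion along a line is exact; the
  mixed terms combine by symmetry of the diagonal matrix.\<close>

lemma quad_model_line:
  assumes A: "diag_matrix_in l u A" and l: "0 \<le> l"
  shows "quad_model c g \<eta> A z (p + s *\<^sub>R d)
    = quad_model c g \<eta> A z p + s * (grad (quad_model c g \<eta> A z) p \<bullet> d)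
      + s\<^sup>2 / (2 * \<eta>) * (mat_norm A d)\<^sup>2"
proof -
  have sym: "d \<bullet> (A *v w) = w \<bullet> (A *v d)" for w
    unfolding inner_vec_def by (simp add: diag_mult_vec[OF A] algebra_simps)
  define e where "e = p - z"
  have 1: "p + s *\<^sub>R d - z = e + s *\<^sub>R d" by (simp add: e_def)
  have 2: "(e + s *\<^sub>R d) \<bullet> (A *v (e + s *\<^sub>R d))
      = e \<bullet> (A *v e) + 2 * s * (d \<bullet> (A *v e)) + s\<^sup>2 * (d \<bullet> (A *v d))"
    by (simp add: matrix_vector_right_distrib matrix_vector_mult_scaleR inner_add_left
        inner_add_right sym[of e] power2_eq_square distrib_left distrib_right mult.assoc)
  have 3: "(g + (1 / \<eta>) *\<^sub>R (A *v e)) \<bullet> d = g \<bullet> d + (1 / \<eta>) * (d \<bullet> (A *v e))"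
    by (simp add: inner_add_left inner_commute[of "A *v e" d])
  have 4: "g \<bullet> (e + s *\<^sub>R d) = g \<bullet> e + s * (g \<bullet> d)"
    by (simp add: inner_add_right)
  show ?thesis
    unfolding grad_quad_model[OF A l] quad_model_def mat_norm_sq[OF A l] 1
      e_def[symmetric] 2 3 4
    \<comment> \<open>No sign of \<open>\<eta>\<close> is assumed: at 0 every quotient by it is zero
      by convention, otherwise the denominators can be cleared.\<close>
    by (cases "\<eta> = 0") (simp_all add: field_simps)
qed

text \<open>Shaped like the step in \<open>y_step\<close>, with the model abstracted to
  \<open>Q\<close>, so that the two agree by unfolding alone.\<close>

definition fw_step_size :: "(real ^ 'n \<Rightarrow> real) \<Rightarrow> real \<Rightarrow> real ^ 'n ^ 'n \<Rightarrow> real \<Rightarrow> real ^ 'n \<Rightarrow> real ^ 'n \<Rightarrow> real"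
  where "fw_step_size Q \<eta> A \<gamma> p w =
    (if w = p then 0 else min (\<eta> * (grad Q p \<bullet> (p - w)) / (mat_norm A (p - w))\<^sup>2) \<gamma>)"

text \<open>
  Along the segment the model is a parabola in the step length whose vertex is the unclipped
  step size, so clipping still decreases the model and does at least as well as the step
  \<open>\<gamma>\<close>.
\<close>

lemma fw_step:
  fixes p w :: "real ^ 'n"
  assumes A: "diag_matrix_in l u A" and l: "0 < l" and \<eta>: "0 < \<eta>" and \<gamma>: "0 \<le> \<gamma>"
    and Q_def: "Q = quad_model c g \<eta> A z" and gap: "0 \<le> grad Q p \<bullet> (p - w)"
    and \<alpha>_def: "\<alpha> = fw_step_size Q \<eta> A \<gamma> p w"
  shows "0 \<le> \<alpha>" "\<alpha> \<le> \<gamma>" "Q (p + \<alpha> *\<^sub>R (w - p)) \<le> Q p"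
    "Q (p + \<alpha> *\<^sub>R (w - p))
      \<le> Q p - \<gamma> * (grad Q p \<bullet> (p - w)) + \<gamma>\<^sup>2 / (2 * \<eta>) * (mat_norm A (p - w))\<^sup>2"
proof -
  define a where "a = grad Q p \<bullet> (p - w)"
  define N where "N = (mat_norm A (p - w))\<^sup>2"
  \<comment> \<open>The step moves along \<open>w - p\<close>, whereas its size is written with
    \<open>p - w\<close>; the quadratic form is even.\<close>
  have N_swap: "(mat_norm A (w - p))\<^sup>2 = N"
    unfolding N_def mat_norm_sq[OF A less_imp_le[OF l]]
    by (simp add: matrix_vector_mult_diff_distrib inner_diff_left inner_diff_right)
  have line: "Q (p + s *\<^sub>R (w - p)) = Q p - s * a + s\<^sup>2 / (2 * \<eta>) * N" for s
    unfolding Q_def quad_model_line[OF A less_imp_le[OF l]] N_swap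
    unfolding a_def Q_def by (simp add: algebra_simps)
  have a0: "0 \<le> a" using gap by (simp add: a_def)
  have "0 \<le> \<alpha> \<and> \<alpha> \<le> \<gamma> \<and> Q (p + \<alpha> *\<^sub>R (w - p)) \<le> Q p
    \<and> Q (p + \<alpha> *\<^sub>R (w - p)) \<le> Q p - \<gamma> * a + \<gamma>\<^sup>2 / (2 * \<eta>) * N"
  proof (cases "w = p")
    case True
    then show ?thesis using \<gamma> by (simp add: \<alpha>_def fw_step_size_def a_def N_def mat_norm_def)
  next
    case False
    define r where "r = \<eta> * a / N"
    have "0 < l * (norm (p - w))\<^sup>2" using l False by simp
    then have N: "0 < N"
      using mat_norm_sq_bounds(1)[OF A less_imp_le[OF l], of "p - w"] unfolding N_def by linarith
    have \<alpha>: "\<alpha> = min r \<gamma>" using False by (simp add: \<alpha>_def fw_step_size_def r_def a_def N_def)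
    have r0: "0 \<le> r" using a0 \<eta> N by (simp add: r_def)
    have a_eq: "a = r * N / \<eta>" using N \<eta> by (simp add: r_def)
    \<comment> \<open>Completing the square: the change of the model at step \<open>s\<close>
      depends only on the distance of \<open>s\<close> from the vertex \<open>r\<close>. Both claims
      thus reduce to comparing the distance of \<open>\<alpha>\<close> from \<open>r\<close> with
      those of 0 and of \<open>\<gamma>\<close>.\<close>
    have par: "- s * a + s\<^sup>2 / (2 * \<eta>) * N = N / (2 * \<eta>) * ((r - s)\<^sup>2 - r\<^sup>2)" for s
      using \<eta> by (simp add: a_eq power2_eq_square field_simps)
    have c0: "0 \<le> N / (2 * \<eta>)" using N \<eta> by simp
    have 1: "(r - \<alpha>)\<^sup>2 \<le> r\<^sup>2"
      using r0 \<gamma> unfolding \<alpha> by (intro power_mono) auto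
    \<comment> \<open>Either \<open>r \<le> \<gamma>\<close> and the left side is zero, or
      \<open>\<alpha> = \<gamma>\<close> and the sides agree.\<close>
    have 2: "(r - \<alpha>)\<^sup>2 \<le> (r - \<gamma>)\<^sup>2"
      using r0 \<gamma> unfolding \<alpha> by (auto simp: min_def)
    have "N / (2 * \<eta>) * ((r - \<alpha>)\<^sup>2 - r\<^sup>2) \<le> 0"
      using c0 1 by (intro mult_nonneg_nonpos) auto
    then have 3: "Q (p + \<alpha> *\<^sub>R (w - p)) \<le> Q p"
      unfolding line par[symmetric] by simp
    have "N / (2 * \<eta>) * ((r - \<alpha>)\<^sup>2 - r\<^sup>2) \<le> N / (2 * \<eta>) * ((r - \<gamma>)\<^sup>2 - r\<^sup>2)"
      using c0 2 by (intro mult_left_mono) auto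
    then have "Q (p + \<alpha> *\<^sub>R (w - p)) \<le> Q p - \<gamma> * a + \<gamma>\<^sup>2 / (2 * \<eta>) * N"
      unfolding line par[symmetric] by simp
    with 3 show ?thesis using r0 \<gamma> \<alpha> by auto
  qed
  then show "0 \<le> \<alpha>" "\<alpha> \<le> \<gamma>" "Q (p + \<alpha> *\<^sub>R (w - p)) \<le> Q p"
    "Q (p + \<alpha> *\<^sub>R (w - p))
      \<le> Q p - \<gamma> * (grad Q p \<bullet> (p - w)) + \<gamma>\<^sup>2 / (2 * \<eta>) * (mat_norm A (p - w))\<^sup>2"
    by (simp_all add: a_def N_def)
qed

text \<open>Convex combinations keep the iterates in \<open>C\<close>, and each step moves by at
  most \<open>\<gamma> * D\<close>, which adds up by the triangle inequality. The model bound is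
  earned entirely by the first step and preserved by the later ones, hence the condition
  \<open>1 \<le> k\<close>.\<close>

lemma fw_inner_loop:
  fixes y v :: "nat \<Rightarrow> real ^ 'n"
  assumes A: "diag_matrix_in l u A" and l: "0 < l" and \<eta>: "0 < \<eta>" and \<gamma>: "0 \<le> \<gamma>" "\<gamma> \<le> 1"
    and C: "convex C" and diam: "\<And>p q. p \<in> C \<Longrightarrow> q \<in> C \<Longrightarrow> norm (p - q) \<le> D"
    and Q_def: "Q = quad_model c g \<eta> A z" and z: "z \<in> C"
    and y0: "y 0 = z"
    and v: "\<And>k. k < K \<Longrightarrow> is_arg_min (\<lambda>w. grad Q (y k) \<bullet> w) (\<lambda>w. w \<in> C) (v k)"
    and y_Suc: "\<And>k. k < K \<Longrightarrow> y (Suc k) = y k + fw_step_size Q \<eta> A \<gamma> (y k) (v k) *\<^sub>R (v k - y k)"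
  shows "k \<le> K \<Longrightarrow> y k \<in> C" "k \<le> K \<Longrightarrow> norm (y k - z) \<le> real k * \<gamma> * D"
    "1 \<le> k \<Longrightarrow> k \<le> K \<Longrightarrow> w \<in> C \<Longrightarrow>
      Q (y k) \<le> c + \<gamma> * (g \<bullet> (w - z)) + \<gamma>\<^sup>2 / (2 * \<eta>) * (u * D\<^sup>2)"
proof -
  have v_C: "v k \<in> C" if "k < K" for k
    using v[OF that] by (simp add: is_arg_min_linorder)
  have v_le: "grad Q (y k) \<bullet> v k \<le> grad Q (y k) \<bullet> w" if "k < K" "w \<in> C" for k w
    using v[OF that(1)] that(2) by (simp add: is_arg_min_linorder)
  have gap: "0 \<le> grad Q (y k) \<bullet> (y k - v k)" if "k < K" "y k \<in> C" for k
    using v_le[OF that] by (simp add: inner_diff_right)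
  note fw = fw_step[OF A l \<eta> \<gamma>(1) Q_def gap refl]
  have y_C: "y k \<in> C" if "k \<le> K" for k
    using that
  proof (induction k)
    case (Suc k)
    then have k: "k < K" "y k \<in> C" by auto
    have "(1 - s) *\<^sub>R y k + s *\<^sub>R v k \<in> C" if "0 \<le> s" "s \<le> 1" for s
      using convexD_alt[OF C k(2) v_C[OF k(1)] that] .
    from this[OF fw(1)[OF k]] show ?case
      using fw(2)[OF k] \<gamma>(2) unfolding y_Suc[OF k(1)] by (simp add: algebra_simps)
  qed (simp add: y0 z)
  then show "k \<le> K \<Longrightarrow> y k \<in> C" .
  show "k \<le> K \<Longrightarrow> norm (y k - z) \<le> real k * \<gamma> * D"
  proof (induction k)
    case (Suc k)
    then have k: "k < K" "y k \<in> C" using y_C by auto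
    define \<alpha> where "\<alpha> = fw_step_size Q \<eta> A \<gamma> (y k) (v k)"
    have "norm (y (Suc k) - z) \<le> norm (y k - z) + norm (\<alpha> *\<^sub>R (v k - y k))"
      using norm_triangle_ineq[of "y k - z" "\<alpha> *\<^sub>R (v k - y k)"]
      unfolding y_Suc[OF k(1)] \<alpha>_def by (simp add: algebra_simps)
    also have "norm (\<alpha> *\<^sub>R (v k - y k)) \<le> \<gamma> * D"
      using fw(1,2)[OF k] diam[OF v_C[OF k(1)] k(2)] \<gamma>(1) unfolding \<alpha>_def[symmetric]
      by (simp add: mult_mono)
    finally show ?case using Suc by (simp add: algebra_simps)
  qed (simp add: y0)
  \<comment> \<open>At its centre the model has value \<open>c\<close> and gradient
    \<open>g\<close>, so the first inner step, taken from \<open>z\<close>, is a Frank-Wolfe step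
    for \<open>g\<close> itself.\<close>
  have Q_z: "Q z = c" "grad Q z = g"
    unfolding Q_def grad_quad_model[OF A less_imp_le[OF l]]
    by (simp_all add: quad_model_def mat_norm_def)
  show "Q (y k) \<le> c + \<gamma> * (g \<bullet> (w - z)) + \<gamma>\<^sup>2 / (2 * \<eta>) * (u * D\<^sup>2)"
    if "1 \<le> k" "k \<le> K" "w \<in> C"
    using that(1,2)
  proof (induction k rule: dec_induct)
    case base
    then have K: "0 < K" by simp
    have y0_C: "y 0 \<in> C" by (simp add: y0 z)
    have "norm (z - v 0) \<le> D" using diam[OF z v_C[OF K]] .
    then have "(norm (z - v 0))\<^sup>2 \<le> D\<^sup>2" by (intro power_mono) auto
    moreover have "0 \<le> u"
      using A l unfolding diag_matrix_in_def by (meson less_imp_le order_trans)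
    ultimately have "(mat_norm A (z - v 0))\<^sup>2 \<le> u * D\<^sup>2"
      using mat_norm_sq_bounds(2)[OF A less_imp_le[OF l], of "z - v 0"]
      by (meson mult_left_mono order_trans)
    then have 1: "\<gamma>\<^sup>2 / (2 * \<eta>) * (mat_norm A (z - v 0))\<^sup>2 \<le> \<gamma>\<^sup>2 / (2 * \<eta>) * (u * D\<^sup>2)"
      using \<eta> by (intro mult_left_mono) auto
    \<comment> \<open>The vertex minimises the linear form over \<open>C\<close>, so it may be
      replaced by any comparison point \<open>w\<close>, later a minimiser of the objective.\<close>
    have "g \<bullet> v 0 \<le> g \<bullet> w" using v_le[OF K that(3)] by (simp add: y0 Q_z)
    then have "g \<bullet> (z - w) \<le> g \<bullet> (z - v 0)" by (simp add: inner_diff_right)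
    then have "\<gamma> * (g \<bullet> (z - w)) \<le> \<gamma> * (g \<bullet> (z - v 0))"
      using \<gamma>(1) by (rule mult_left_mono)
    moreover have "\<gamma> * (g \<bullet> (z - w)) = - (\<gamma> * (g \<bullet> (w - z)))"
      by (simp add: algebra_simps)
    ultimately show ?case
      using fw(4)[OF K y0_C] 1 y_Suc[OF K] by (simp add: y0 Q_z)
  next
    case (step k)
    then have "k < K" "y k \<in> C" using y_C by auto
    with fw(3) step show ?case by (fastforce simp: y_Suc)
  qed
qed

section \<open>Variance of the sampled gradient\<close>

text \<open>Integrability and value are bundled, so that both can be read off a single fact.\<close>

lemma has_bochner_integral_double_sum:
  fixes g :: "'b \<Rightarrow> 'c \<Rightarrow> 'a \<Rightarrow> 'd::{banach, second_countable_topology}"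
  assumes "\<And>a c. a \<in> A \<Longrightarrow> c \<in> B \<Longrightarrow> integrable M (g a c)"
  shows "has_bochner_integral M (\<lambda>\<omega>. \<Sum>a\<in>A. \<Sum>c\<in>B. g a c \<omega>)
    (\<Sum>a\<in>A. \<Sum>c\<in>B. integral\<^sup>L M (g a c))"
  by (intro has_bochner_integral_sum has_bochner_integral_integrable assms)

lemmas integral_double_sum = has_bochner_integral_double_sum[THEN has_bochner_integral_integral_eq]

text \<open>The events generated by \<open>u\<close> and by \<open>w\<close> lie in \<open>F\<close>
  and \<open>F'\<close>, so independence passes from the two algebras to the two variables, whose
  expectations then multiply.\<close>

lemma (in prob_space) expectation_mult_indep_subalgebras:
  fixes u w :: "'a \<Rightarrow> real"
  assumes indep: "indep_set (sets F) (sets F')" and sub: "subalgebra M F" "subalgebra M F'"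
    and meas: "u \<in> borel_measurable F" "w \<in> borel_measurable F'"
    and int: "integrable M u" "integrable M w"
  shows "integrable M (\<lambda>\<omega>. u \<omega> * w \<omega>)"
    "expectation (\<lambda>\<omega>. u \<omega> * w \<omega>) = expectation u * expectation w"
proof -
  have gen: "sigma_sets (space M) {z -` A \<inter> space M |A. A \<in> sets borel} \<subseteq> sets N"
    if "subalgebra M N" "z \<in> borel_measurable N" for z :: "'a \<Rightarrow> real" and N
  proof -
    have sp: "space N = space M" using that(1) by (simp add: subalgebra_def)
    then show ?thesis
      using measurable_sets[OF that(2)] by (intro sets.sigma_sets_subset[of _ N, unfolded sp]) auto
  qed
  have "indep_var borel u borel w"
    unfolding indep_var_eq using indep meas sub gen[OF sub(1) meas(1)] gen[OF sub(2) meas(2)]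
    unfolding indep_sets2_eq by (blast intro: measurable_from_subalg)
  then show "integrable M (\<lambda>\<omega>. u \<omega> * w \<omega>)"
    "expectation (\<lambda>\<omega>. u \<omega> * w \<omega>) = expectation u * expectation w"
    using int by (simp_all add: indep_var_integrable indep_var_lebesgue_integral)
qed

text \<open>
  Conditionally on the \<open>\<sigma>\<close>-algebra \<open>F\<close> the samples are independent and uniform, so the mixed
  terms of the squared norm contain the factor \<open>\<Sum>i. u i = 0\<close>.
\<close>

lemma (in prob_space) expectation_norm_sq_centred_sample_sum:
  fixes u :: "nat \<Rightarrow> 'a \<Rightarrow> 'v::euclidean_space"
  assumes F: "subalgebra M F"
    and u_meas: "\<And>i. i \<in> {1..m} \<Longrightarrow> u i \<in> borel_measurable F"
    and u_bound: "\<And>i \<omega>. i \<in> {1..m} \<Longrightarrow> \<omega> \<in> space M \<Longrightarrow> norm (u i \<omega>) \<le> B"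
    and u_centred: "\<And>\<omega>. \<omega> \<in> space M \<Longrightarrow> (\<Sum>i\<in>{1..m}. u i \<omega>) = 0"
    and J_meas: "\<And>j. j \<in> {1..b} \<Longrightarrow> J j \<in> measurable M (count_space {1..m})"
    and J_uniform: "\<And>j. j \<in> {1..b} \<Longrightarrow>
      distr M (count_space {1..m}) (J j) = uniform_count_measure {1..m}"
    and J_indep: "indep_vars (\<lambda>_. count_space {1..m}) J {1..b}"
    and J_indep_F: "indep_set (sets F) (sets (vimage_algebra (space M)
      (\<lambda>\<omega>. \<lambda>j\<in>{1..b}. J j \<omega>) (PiM {1..b} (\<lambda>_. count_space {1..m}))))"
  shows "expectation (\<lambda>\<omega>. (norm (\<Sum>j\<in>{1..b}. u (J j \<omega>) \<omega>))\<^sup>2)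
    = real b / real m * (\<Sum>i\<in>{1..m}. expectation (\<lambda>\<omega>. (norm (u i \<omega>))\<^sup>2))"
proof -
  define S where "S = vimage_algebra (space M)
      (\<lambda>\<omega>. \<lambda>j\<in>{1..b}. J j \<omega>) (PiM {1..b} (\<lambda>_. count_space {1..m}))"
  \<comment> \<open>Splitting into these cells replaces the random indices of \<open>u\<close> by
    fixed ones, at the price of an indicator.\<close>
  define E where "E j k a c = {\<omega> \<in> space M. J j \<omega> = a \<and> J k \<omega> = c}" for j k a c
  have S: "subalgebra M S"
    using indep_setD_ev2[OF J_indep_F] by (simp add: subalgebra_def S_def)
  have J_in: "J j \<omega> \<in> {1..m}" if "j \<in> {1..b}" "\<omega> \<in> space M" for j \<omega>
    using measurable_space[OF J_meas[OF that(1)] that(2)] by simp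
  \<comment> \<open>Membership in \<open>S\<close>, not merely in \<open>M\<close>, is what makes
    the cells independent of \<open>F\<close>.\<close>
  have E_sets: "E j k a c \<in> sets S" if jk: "j \<in> {1..b}" "k \<in> {1..b}" for j k a c
  proof -
    let ?P = "PiM {1..b} (\<lambda>_. count_space {1..m})"
    have "(\<lambda>s. s i) \<in> measurable ?P (count_space {1..m})" if "i \<in> {1..b}" for i
      using that by (rule measurable_component_singleton)
    from this[OF jk(1)] this[OF jk(2)] have "{s \<in> space ?P. s j = a \<and> s k = c} \<in> sets ?P"
      by measurable
    note in_vimage_algebra[OF this, of "\<lambda>\<omega>. \<lambda>j\<in>{1..b}. J j \<omega>" "space M"]
    moreover have "(\<lambda>\<omega>. \<lambda>j\<in>{1..b}. J j \<omega>) -` {s \<in> space ?P. s j = a \<and> s k = c} \<inter> space M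
        = E j k a c"
      using jk J_in by (auto simp: E_def space_PiM)
    ultimately show ?thesis unfolding S_def by simp
  qed
  have uu_bound: "norm (u a \<omega> \<bullet> u c \<omega>) \<le> B * B"
    if "a \<in> {1..m}" "c \<in> {1..m}" "\<omega> \<in> space M" for a c \<omega>
  proof -
    have "norm (u a \<omega> \<bullet> u c \<omega>) \<le> norm (u a \<omega>) * norm (u c \<omega>)"
      using Cauchy_Schwarz_ineq2 by simp
    also have "\<dots> \<le> B * B"
      using u_bound that norm_ge_zero order_trans by (intro mult_mono) blast+
    finally show ?thesis .
  qed
  have uu_meas: "(\<lambda>\<omega>. u a \<omega> \<bullet> u c \<omega>) \<in> borel_measurable F"
    if "a \<in> {1..m}" "c \<in> {1..m}" for a c
    using u_meas that by (intro borel_measurable_inner) auto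
  have uu_int: "integrable M (\<lambda>\<omega>. u a \<omega> \<bullet> u c \<omega>)" if "a \<in> {1..m}" "c \<in> {1..m}" for a c
    using uu_bound that measurable_from_subalg[OF F uu_meas]
    by (intro integrable_const_bound[where B = "B * B"] AE_I2) auto
  have E_int: "integrable M (indicat_real (E j k a c))" if "j \<in> {1..b}" "k \<in> {1..b}" for j k a c
    using E_sets[OF that] S by (intro integrable_real_indicator) (auto simp: subalgebra_def emeasure_eq_measure)
  have E_prob: "expectation (indicat_real (E j k a c)) = prob (E j k a c)" for j k a c
    by (simp add: E_def Int_absorb2 subset_eq)
  \<comment> \<open>The inner product is known to \<open>F\<close> and the cell to \<open>S\<close>,
    so the expectation factors.\<close>
  have cell: "integrable M (\<lambda>\<omega>. (u a \<omega> \<bullet> u c \<omega>) * indicat_real (E j k a c) \<omega>)"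
    "expectation (\<lambda>\<omega>. (u a \<omega> \<bullet> u c \<omega>) * indicat_real (E j k a c) \<omega>)
      = expectation (\<lambda>\<omega>. u a \<omega> \<bullet> u c \<omega>) * prob (E j k a c)"
    if "a \<in> {1..m}" "c \<in> {1..m}" "j \<in> {1..b}" "k \<in> {1..b}" for a c j k
    using expectation_mult_indep_subalgebras[OF J_indep_F[folded S_def] F S uu_meas[OF that(1,2)]
        borel_measurable_indicator[OF E_sets[OF that(3,4)]] uu_int[OF that(1,2)] E_int[OF that(3,4)]]
    unfolding E_prob by auto
  \<comment> \<open>For each outcome exactly one cell is active, namely the one of the indices
    actually drawn.\<close>
  have split: "u (J j \<omega>) \<omega> \<bullet> u (J k \<omega>) \<omega>
      = (\<Sum>a\<in>{1..m}. \<Sum>c\<in>{1..m}. (u a \<omega> \<bullet> u c \<omega>) * indicat_real (E j k a c) \<omega>)"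
    if "j \<in> {1..b}" "k \<in> {1..b}" "\<omega> \<in> space M" for j k \<omega>
  proof -
    have "(\<Sum>a\<in>{1..m}. \<Sum>c\<in>{1..m}. (u a \<omega> \<bullet> u c \<omega>) * indicat_real (E j k a c) \<omega>)
        = (\<Sum>a\<in>{1..m}. \<Sum>c\<in>{1..m}. if c = J k \<omega> then if a = J j \<omega> then u a \<omega> \<bullet> u c \<omega> else 0 else 0)"
      using that by (intro sum.cong) (auto simp: E_def indicator_def)
    also have "\<dots> = (\<Sum>a\<in>{1..m}. if a = J j \<omega> then u a \<omega> \<bullet> u (J k \<omega>) \<omega> else 0)"
      using J_in[OF that(2,3)] by (intro sum.cong) auto
    finally show ?thesis using J_in[OF that(1,3)] by simp
  qed
  have pair_int: "integrable M (\<lambda>\<omega>. u (J j \<omega>) \<omega> \<bullet> u (J k \<omega>) \<omega>)"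
    and pair: "expectation (\<lambda>\<omega>. u (J j \<omega>) \<omega> \<bullet> u (J k \<omega>) \<omega>)
      = (\<Sum>a\<in>{1..m}. \<Sum>c\<in>{1..m}. expectation (\<lambda>\<omega>. u a \<omega> \<bullet> u c \<omega>) * prob (E j k a c))"
    if jk: "j \<in> {1..b}" "k \<in> {1..b}" for j k
  proof -
    define Z where "Z a c \<omega> = (u a \<omega> \<bullet> u c \<omega>) * indicat_real (E j k a c) \<omega>" for a c \<omega>
    have Z: "integrable M (Z a c)"
      "expectation (Z a c) = expectation (\<lambda>\<omega>. u a \<omega> \<bullet> u c \<omega>) * prob (E j k a c)"
      if "a \<in> {1..m}" "c \<in> {1..m}" for a c
      unfolding Z_def by (rule cell[OF that jk])+
    have sum_Z: "has_bochner_integral M (\<lambda>\<omega>. \<Sum>a\<in>{1..m}. \<Sum>c\<in>{1..m}. Z a c \<omega>)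
        (\<Sum>a\<in>{1..m}. \<Sum>c\<in>{1..m}. expectation (Z a c))"
      by (intro has_bochner_integral_double_sum Z(1))
    note split_Z = split[OF jk, folded Z_def]
    show "integrable M (\<lambda>\<omega>. u (J j \<omega>) \<omega> \<bullet> u (J k \<omega>) \<omega>)"
      using integrable.intros[OF sum_Z]
      by (simp add: split_Z cong: Bochner_Integration.integrable_cong)
    show "expectation (\<lambda>\<omega>. u (J j \<omega>) \<omega> \<bullet> u (J k \<omega>) \<omega>)
      = (\<Sum>a\<in>{1..m}. \<Sum>c\<in>{1..m}. expectation (\<lambda>\<omega>. u a \<omega> \<bullet> u c \<omega>) * prob (E j k a c))"
      using has_bochner_integral_integral_eq[OF sum_Z] Z(2)
      by (simp add: split_Z cong: Bochner_Integration.integral_cong)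
  qed
  have single: "prob {\<omega> \<in> space M. J j \<omega> = a} = 1 / real m"
    if "j \<in> {1..b}" "a \<in> {1..m}" for j a
  proof -
    have "{\<omega> \<in> space M. J j \<omega> = a} = J j -` {a} \<inter> space M" by auto
    then have "prob {\<omega> \<in> space M. J j \<omega> = a} = measure (distr M (count_space {1..m}) (J j)) {a}"
      using measure_distr[OF J_meas[OF that(1)], of "{a}"] that(2) by simp
    then show ?thesis
      unfolding J_uniform[OF that(1)] using that(2) by (simp add: measure_uniform_count_measure)
  qed
  \<comment> \<open>For distinct samples every cell has probability
    \<open>1 / (real m)\<^sup>2\<close>, so the double sum is a multiple of the expected inner
    product of the sum of all \<open>u a\<close> with itself, which vanishes by centring.\<close>
  have off_diag: "expectation (\<lambda>\<omega>. u (J j \<omega>) \<omega> \<bullet> u (J k \<omega>) \<omega>) = 0"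
    if jk: "j \<in> {1..b}" "k \<in> {1..b}" "j \<noteq> k" for j k
  proof -
    have "prob (E j k a c) = 1 / (real m)\<^sup>2" if ac: "a \<in> {1..m}" "c \<in> {1..m}" for a c
    proof -
      let ?A = "\<lambda>i. if i = j then {a} else {c}"
      have "prob (\<Inter>i\<in>{j, k}. J i -` ?A i \<inter> space M) = (\<Prod>i\<in>{j, k}. prob (J i -` ?A i \<inter> space M))"
        using jk ac by (intro indep_varsD[OF J_indep]) auto
      moreover have "(\<Inter>i\<in>{j, k}. J i -` ?A i \<inter> space M) = E j k a c"
        using jk(3) by (auto simp: E_def)
      moreover have "J i -` {d} \<inter> space M = {\<omega> \<in> space M. J i \<omega> = d}" for i d
        by auto
      ultimately show ?thesis
        using jk ac single by (simp add: power2_eq_square)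
    qed
    then have "expectation (\<lambda>\<omega>. u (J j \<omega>) \<omega> \<bullet> u (J k \<omega>) \<omega>)
        = (\<Sum>a\<in>{1..m}. \<Sum>c\<in>{1..m}. expectation (\<lambda>\<omega>. u a \<omega> \<bullet> u c \<omega>)) * (1 / (real m)\<^sup>2)"
      unfolding pair[OF jk(1,2)] sum_distrib_right by (intro sum.cong) auto
    also have "(\<Sum>a\<in>{1..m}. \<Sum>c\<in>{1..m}. expectation (\<lambda>\<omega>. u a \<omega> \<bullet> u c \<omega>))
        = expectation (\<lambda>\<omega>. \<Sum>a\<in>{1..m}. \<Sum>c\<in>{1..m}. u a \<omega> \<bullet> u c \<omega>)"
      using uu_int by (intro integral_double_sum[symmetric])
    also have "\<dots> = expectation (\<lambda>\<omega>. 0)"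
      using u_centred
      by (intro Bochner_Integration.integral_cong)
        (auto simp: inner_sum_left[symmetric] inner_sum_right[symmetric])
    finally show ?thesis by simp
  qed
  \<comment> \<open>A sample paired with itself charges only the cells with \<open>a = c\<close>,
    each with probability \<open>1 / real m\<close>.\<close>
  have diag: "expectation (\<lambda>\<omega>. u (J j \<omega>) \<omega> \<bullet> u (J j \<omega>) \<omega>)
      = (\<Sum>i\<in>{1..m}. expectation (\<lambda>\<omega>. (norm (u i \<omega>))\<^sup>2)) / real m"
    if j: "j \<in> {1..b}" for j
  proof -
    have "prob (E j j a c) = (if c = a then 1 / real m else 0)" if "a \<in> {1..m}" for a c
    proof (cases "c = a")
      case True
      then show ?thesis using single[OF j that] by (simp add: E_def)
    next
      case False
      then have "E j j a c = {}" by (auto simp: E_def)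
      with False show ?thesis by simp
    qed
    then have "expectation (\<lambda>\<omega>. u (J j \<omega>) \<omega> \<bullet> u (J j \<omega>) \<omega>)
        = (\<Sum>a\<in>{1..m}. \<Sum>c\<in>{1..m}. if c = a then expectation (\<lambda>\<omega>. u a \<omega> \<bullet> u c \<omega>) / real m else 0)"
      unfolding pair[OF j j] by (intro sum.cong) auto
    then show ?thesis by (simp add: power2_norm_eq_inner sum_divide_distrib)
  qed
  have "expectation (\<lambda>\<omega>. (norm (\<Sum>j\<in>{1..b}. u (J j \<omega>) \<omega>))\<^sup>2)
      = expectation (\<lambda>\<omega>. \<Sum>j\<in>{1..b}. \<Sum>k\<in>{1..b}. u (J j \<omega>) \<omega> \<bullet> u (J k \<omega>) \<omega>)"
    by (simp add: power2_norm_eq_inner inner_sum_left inner_sum_right inner_commute)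
  also have "\<dots> = (\<Sum>j\<in>{1..b}. \<Sum>k\<in>{1..b}. expectation (\<lambda>\<omega>. u (J j \<omega>) \<omega> \<bullet> u (J k \<omega>) \<omega>))"
    using pair_int by (intro integral_double_sum)
  also have "\<dots> = (\<Sum>j\<in>{1..b}. \<Sum>k\<in>{1..b}. if k = j
      then (\<Sum>i\<in>{1..m}. expectation (\<lambda>\<omega>. (norm (u i \<omega>))\<^sup>2)) / real m else 0)"
    using off_diag diag by (intro sum.cong) auto
  finally show ?thesis by simp
qed

text \<open>A variance is at most the second moment: subtracting the mean removes
  \<open>real m * (\<mu> \<bullet> \<mu>)\<close> from the sum. Bounding each deviation by
  \<open>2 * B\<close> would lose a factor 4.\<close>

lemma average_norm_sq_centred_le:
  fixes w :: "nat \<Rightarrow> 'a::real_inner"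
  assumes m: "1 \<le> m" and w: "\<And>i. i \<in> {1..m} \<Longrightarrow> norm (w i) \<le> B"
    and \<mu>: "\<mu> = (1 / real m) *\<^sub>R (\<Sum>i\<in>{1..m}. w i)"
  shows "(\<Sum>i\<in>{1..m}. (norm (w i - \<mu>))\<^sup>2) \<le> real m * B\<^sup>2"
proof -
  have sum_w: "(\<Sum>i\<in>{1..m}. w i) = real m *\<^sub>R \<mu>"
    using m by (simp add: \<mu>)
  have "(norm (w i - \<mu>))\<^sup>2 = (norm (w i))\<^sup>2 - 2 * (w i \<bullet> \<mu>) + \<mu> \<bullet> \<mu>" for i
    unfolding power2_norm_eq_inner by (simp add: inner_diff_left inner_diff_right inner_commute)
  then have "(\<Sum>i\<in>{1..m}. (norm (w i - \<mu>))\<^sup>2)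
      = (\<Sum>i\<in>{1..m}. (norm (w i))\<^sup>2) - 2 * ((\<Sum>i\<in>{1..m}. w i) \<bullet> \<mu>) + real m * (\<mu> \<bullet> \<mu>)"
    by (simp add: sum.distrib sum_subtractf sum_distrib_left inner_sum_left)
  also have "\<dots> = (\<Sum>i\<in>{1..m}. (norm (w i))\<^sup>2) - real m * (\<mu> \<bullet> \<mu>)"
    unfolding sum_w by simp
  also have "\<dots> \<le> (\<Sum>i\<in>{1..m}. (norm (w i))\<^sup>2)"
    by simp
  also have "\<dots> \<le> (\<Sum>i\<in>{1..m}. B\<^sup>2)"
    using w by (intro sum_mono power_mono) auto
  finally show ?thesis by simp
qed

section \<open>One iteration of AdaSFW\<close>

lemma borel_measurable_matrix_vector_mult [measurable (raw)]:
  fixes A :: "'a \<Rightarrow> real ^ 'n ^ 'k"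
  assumes "A \<in> borel_measurable N" "w \<in> borel_measurable N"
  shows "(\<lambda>\<omega>. A \<omega> *v w \<omega>) \<in> borel_measurable N"
proof (rule borel_measurable_continuous_Pair[OF assms])
  show "continuous_on UNIV (\<lambda>p. fst p *v snd p :: real ^ 'k)"
    unfolding matrix_vector_mult_def
    by (intro continuous_on_vec_lambda continuous_on_sum continuous_on_mult continuous_on_component
        continuous_on_fst continuous_on_snd continuous_on_id)
qed

lemma borel_measurable_mat_norm [measurable (raw)]:
  assumes "A \<in> borel_measurable N" "w \<in> borel_measurable N"
  shows "(\<lambda>\<omega>. mat_norm (A \<omega>) (w \<omega>)) \<in> borel_measurable N"
  unfolding mat_norm_def using assms by measurable

text \<open>The sampled index is itself random; as it takes finitely many values, measurability is
  checked for each value. \<open>N\<close> is left open because both \<open>past (Suc t)\<close> and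
  \<open>M\<close> are used.\<close>

lemma borel_measurable_batch_grad:
  assumes f: "\<And>i. i \<in> {1..m} \<Longrightarrow> smooth_fun (f i)"
    and J: "\<And>j. j \<in> {1..b} \<Longrightarrow> J j \<in> measurable N (count_space {1..m})"
    and z: "z \<in> borel_measurable N"
  shows "(\<lambda>\<omega>. batch_grad f b (\<lambda>j. J j \<omega>) (z \<omega>)) \<in> borel_measurable N"
proof -
  have "(\<lambda>\<omega>. grad (f i) (z \<omega>)) \<in> borel_measurable N" if "i \<in> {1..m}" for i
    using borel_measurable_continuous_onI[OF continuous_on_grad[OF f[OF that]]]
    by (rule measurable_compose[OF z])
  then have "(\<lambda>\<omega>. grad (f (J j \<omega>)) (z \<omega>)) \<in> borel_measurable N" if "j \<in> {1..b}" for j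
    using J[OF that] by (rule measurable_compose_countable') auto
  then show ?thesis
    unfolding batch_grad_def by measurable
qed

section \<open>The iterates: pathwise bounds and measurability\<close>

context AdaSFW
begin

definition stoch_grad :: "nat \<Rightarrow> 'w \<Rightarrow> real ^ 'n"
  where "stoch_grad t \<omega> = batch_grad f (b t) (\<lambda>j. I t j \<omega>) (x t \<omega>)"

definition model :: "nat \<Rightarrow> 'w \<Rightarrow> real ^ 'n \<Rightarrow> real"
  where "model t \<omega> = quad_model (avg_fun m f (x t \<omega>)) (stoch_grad t \<omega>) (\<eta> t) (H t \<omega>) (x t \<omega>)"

lemma grad_model:
  assumes "t < T" "\<omega> \<in> space M"
  shows "grad (model t \<omega>) p = stoch_grad t \<omega> + (1 / \<eta> t) *\<^sub>R (H t \<omega> *v (p - x t \<omega>))"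
  unfolding model_def by (rule grad_quad_model[OF H_diag[OF assms] less_imp_le[OF bounds(1)]])

lemma inner_step:
  assumes "t < T" "k < K" "\<omega> \<in> space M"
  shows "y t (Suc k) \<omega> = y t k \<omega>
    + fw_step_size (model t \<omega>) (\<eta> t) (H t \<omega>) (\<gamma> t) (y t k \<omega>) (v t k \<omega>) *\<^sub>R (v t k \<omega> - y t k \<omega>)"
  using y_step[OF assms] unfolding fw_step_size_def model_def stoch_grad_def .

lemma lp_pos: "0 < lp t"
  using bounds(1)[of 0] bounds by (cases t) (force intro: less_le_trans order.trans)+

lemma
  shows convex_C: "convex C" and dist_C: "p \<in> C \<Longrightarrow> q \<in> C \<Longrightarrow> norm (p - q) \<le> diameter C"
  using C_problem diameter_bounded_bound[OF compact_imp_bounded[OF C_problem(1)], of p q]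
  by (simp_all add: dist_norm)

text \<open>This holds outcome by outcome: the noise is hidden in \<open>stoch_grad\<close>, and no
  probability is involved.\<close>

lemma inner_loop:
  assumes t: "t < T" and \<omega>: "\<omega> \<in> space M" and x: "x t \<omega> \<in> C"
  shows "x (Suc t) \<omega> \<in> C"
    "norm (x (Suc t) \<omega> - x t \<omega>) \<le> real K * \<gamma> t * diameter C"
    "w \<in> C \<Longrightarrow> model t \<omega> (x (Suc t) \<omega>) \<le> avg_fun m f (x t \<omega>)
      + \<gamma> t * (stoch_grad t \<omega> \<bullet> (w - x t \<omega>)) + (\<gamma> t)\<^sup>2 / (2 * \<eta> t) * (lp t * (diameter C)\<^sup>2)"
proof -
  have \<gamma>: "0 \<le> \<gamma> t" "\<gamma> t \<le> 1" using gamma_range[of t] by auto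
  have v: "is_arg_min (\<lambda>w. grad (model t \<omega>) (y t k \<omega>) \<bullet> w) (\<lambda>w. w \<in> C) (v t k \<omega>)" if "k < K" for k
    using v_choice[OF t that \<omega>] unfolding model_def stoch_grad_def .
  \<comment> \<open>The loop is read at its last index \<open>K\<close>; the model bound there uses
    \<open>K_pos\<close>.\<close>
  note loop = fw_inner_loop[OF H_diag[OF t \<omega>] bounds(1) eta_pos \<gamma> convex_C dist_C model_def x,
      where y = "\<lambda>k. y t k \<omega>" and v = "\<lambda>k. v t k \<omega>", OF _ _ y_init[OF t \<omega>] v inner_step[OF t _ \<omega>],
      of K, simplified]
  show "x (Suc t) \<omega> \<in> C"
    "norm (x (Suc t) \<omega> - x t \<omega>) \<le> real K * \<gamma> t * diameter C"
    "w \<in> C \<Longrightarrow> model t \<omega> (x (Suc t) \<omega>) \<le> avg_fun m f (x t \<omega>)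
      + \<gamma> t * (stoch_grad t \<omega> \<bullet> (w - x t \<omega>)) + (\<gamma> t)\<^sup>2 / (2 * \<eta> t) * (lp t * (diameter C)\<^sup>2)"
    unfolding x_step[OF t \<omega>] using loop K_pos by auto
qed

lemma x_in_C: "t \<le> T \<Longrightarrow> \<omega> \<in> space M \<Longrightarrow> x t \<omega> \<in> C"
  by (induction t) (auto simp: x_init x0_in inner_loop(1))

lemma past_Suc_measurable:
  assumes "t < T"
  shows "z \<in> measurable (past t) N \<Longrightarrow> z \<in> measurable (past (Suc t)) N"
    "z \<in> measurable (mid t) N \<Longrightarrow> z \<in> measurable (past (Suc t)) N"
  using history(3,4)[OF assms] by (blast intro: measurable_from_subalg)+

text \<open>Independence of the new samples is stated relative to \<open>past t\<close>, so the
  iterate must be known there. An outer induction over iterations encloses one over inner steps;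
  matrices and samples enter through \<open>mid t\<close>, vertices through
  \<open>v_known\<close>.\<close>

lemma x_measurable: "t \<le> T \<Longrightarrow> x t \<in> borel_measurable (past t)"
proof (induction t)
  case 0
  have "space (past 0) = space M" using history(1)[of 0] by (simp add: subalgebra_def)
  then show ?case
    using x_init by (subst measurable_cong[where g = "\<lambda>_. x0"]) auto
next
  case (Suc t)
  then have t: "t < T" by simp
  let ?F = "past (Suc t)"
  have sp: "space ?F = space M"
    using history(1)[of "Suc t"] t by (simp add: subalgebra_def)
  have x [measurable]: "x t \<in> borel_measurable ?F"
    using Suc t by (intro past_Suc_measurable(1)) auto
  have H [measurable]: "H t \<in> borel_measurable ?F"
    using H_known[OF t] by (rule past_Suc_measurable(2)[OF t])
  have g [measurable]: "stoch_grad t \<in> borel_measurable ?F"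
    unfolding stoch_grad_def[abs_def]
    by (rule borel_measurable_batch_grad[OF f_smooth past_Suc_measurable(2)[OF t sample_known[OF t]] x])
  have "y t k \<in> borel_measurable ?F" if "k \<le> K" for k
    using that
  proof (induction k)
    case 0
    show ?case
      using x by (subst measurable_cong[where g = "x t"]) (auto simp: sp y_init[OF t])
  next
    case (Suc k)
    then have k: "k < K" and y [measurable]: "y t k \<in> borel_measurable ?F" by auto
    have v [measurable]: "v t k \<in> borel_measurable ?F" by (rule v_known[OF t k])
    \<comment> \<open>\<open>grad\<close> is a definite description; the closed form of the model
      gradient makes measurability visible.\<close>
    let ?G = "\<lambda>\<omega>. stoch_grad t \<omega> + (1 / \<eta> t) *\<^sub>R (H t \<omega> *v (y t k \<omega> - x t \<omega>))"
    let ?Y = "\<lambda>\<omega>. y t k \<omega> + (if v t k \<omega> = y t k \<omega> then 0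
          else min (\<eta> t * (?G \<omega> \<bullet> (y t k \<omega> - v t k \<omega>)) / (mat_norm (H t \<omega>) (y t k \<omega> - v t k \<omega>))\<^sup>2) (\<gamma> t))
        *\<^sub>R (v t k \<omega> - y t k \<omega>)"
    have "y t (Suc k) \<omega> = ?Y \<omega>" if "\<omega> \<in> space ?F" for \<omega>
      using that by (simp add: sp inner_step[OF t k] fw_step_size_def grad_model[OF t])
    moreover have "?Y \<in> borel_measurable ?F"
      by measurable
    ultimately show ?case
      by (subst measurable_cong)
  qed
  from this[of K] show ?case
    by (subst measurable_cong[where g = "y t K"]) (auto simp: sp x_step[OF t])
qed

section \<open>The gradient error and the progress of one iteration\<close>

lemma avg_grad_eq: "grad (avg_fun m f) z = (1 / real m) *\<^sub>R (\<Sum>i\<in>{1..m}. grad (f i) z)"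
  using GDERIV_avg_fun[of m f] f_smooth by (intro grad_eqI) auto

lemma GDERIV_avg: "GDERIV (avg_fun m f) z :> grad (avg_fun m f) z"
  using GDERIV_avg_fun[of m f] f_smooth unfolding avg_grad_eq by auto

lemma continuous_on_avg_fun: "continuous_on S (avg_fun m f)"
  unfolding avg_fun_def[abs_def] using f_smooth
  by (intro continuous_intros continuous_on_smooth_fun) auto

lemma continuous_on_avg_grad: "continuous_on S (grad (avg_fun m f))"
  unfolding avg_grad_eq[abs_def] using f_smooth
  by (intro continuous_intros continuous_on_grad) auto

text \<open>The deviations \<open>u i\<close> of the individual gradients from their mean are known
  to \<open>past t\<close> and sum to zero, so the variance formula applies to the batch. The
  pointwise bound later supplies integrability.\<close>

lemma expectation_grad_error_sq:
  assumes t: "t < T"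
  defines "err \<equiv> \<lambda>\<omega>. norm (stoch_grad t \<omega> - grad (avg_fun m f) (x t \<omega>))"
  shows "err \<in> borel_measurable M"
    "\<And>\<omega>. \<omega> \<in> space M \<Longrightarrow> err \<omega> \<le> 2 * grad_bound m f C"
    "expectation (\<lambda>\<omega>. (err \<omega>)\<^sup>2) \<le> (grad_bound m f C)\<^sup>2 / real (b t)"
proof -
  define G where "G = grad_bound m f C"
  define u where "u i \<omega> = grad (f i) (x t \<omega>) - grad (avg_fun m f) (x t \<omega>)" for i \<omega>
  have F: "subalgebra M (past t)" and x_F: "x t \<in> borel_measurable (past t)"
    using history(1) x_measurable t by auto
  have I_M: "I t j \<in> measurable M (count_space {1..m})" if "j \<in> {1..b t}" for j
    using sample_known[OF t that] by (rule measurable_from_subalg[OF history(2)[OF t]])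
  have I_in: "I t j \<omega> \<in> {1..m}" if "j \<in> {1..b t}" "\<omega> \<in> space M" for j \<omega>
    using measurable_space[OF I_M[OF that(1)] that(2)] by simp
  have grad_G: "norm (grad (f i) (x t \<omega>)) \<le> G" if "i \<in> {1..m}" "\<omega> \<in> space M" for i \<omega>
    using norm_grad_le_grad_bound[where f = f, OF C_problem(1) f_smooth[OF that(1)] that(1) x_in_C[OF less_imp_le[OF t] that(2)]]
    unfolding G_def .
  have avg_G: "norm (grad (avg_fun m f) (x t \<omega>)) \<le> G" if "\<omega> \<in> space M" for \<omega>
    unfolding avg_grad_eq using grad_G[OF _ that] by (intro norm_average_le m_pos)
  have u_meas: "u i \<in> borel_measurable (past t)" if "i \<in> {1..m}" for i
    unfolding u_def using that f_smooth continuous_on_grad continuous_on_avg_grad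
    by (intro borel_measurable_diff measurable_compose[OF x_F] borel_measurable_continuous_onI) auto
  have u_bound: "norm (u i \<omega>) \<le> 2 * G" if "i \<in> {1..m}" "\<omega> \<in> space M" for i \<omega>
    using norm_triangle_ineq4[of "grad (f i) (x t \<omega>)" "grad (avg_fun m f) (x t \<omega>)"]
      grad_G[OF that] avg_G[OF that(2)] unfolding u_def by simp
  have u_centred: "(\<Sum>i\<in>{1..m}. u i \<omega>) = 0" for \<omega>
    using m_pos by (simp add: u_def sum_subtractf avg_grad_eq sum_constant_scaleR del: sum_constant)
  have err_eq: "err \<omega> = norm (\<Sum>j\<in>{1..b t}. u (I t j \<omega>) \<omega>) / real (b t)" for \<omega>
  proof -
    have "stoch_grad t \<omega> - grad (avg_fun m f) (x t \<omega>)
        = (1 / real (b t)) *\<^sub>R (\<Sum>j\<in>{1..b t}. u (I t j \<omega>) \<omega>)"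
      using b_pos[of t]
      by (simp add: stoch_grad_def batch_grad_def u_def sum_subtractf sum_constant_scaleR
          scaleR_diff_right del: sum_constant)
    then show ?thesis unfolding err_def by simp
  qed
  have u_sq_int: "integrable M (\<lambda>\<omega>. (norm (u i \<omega>))\<^sup>2)" if "i \<in> {1..m}" for i
    using power_mono[OF u_bound[OF that] norm_ge_zero, of _ 2]
      measurable_from_subalg[OF F u_meas[OF that]]
    by (intro integrable_const_bound[where B = "(2 * G)\<^sup>2"] AE_I2) auto
  \<comment> \<open>The sum goes inside the expectation because the variance bound holds for the
    whole sum at each outcome.\<close>
  have "(\<Sum>i\<in>{1..m}. expectation (\<lambda>\<omega>. (norm (u i \<omega>))\<^sup>2)) = expectation (\<lambda>\<omega>. \<Sum>i\<in>{1..m}. (norm (u i \<omega>))\<^sup>2)"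
    using u_sq_int by (intro Bochner_Integration.integral_sum[symmetric])
  also have "\<dots> \<le> real m * G\<^sup>2"
  proof (intro integral_le_const AE_I2 Bochner_Integration.integrable_sum u_sq_int)
    show "(\<Sum>i\<in>{1..m}. (norm (u i \<omega>))\<^sup>2) \<le> real m * G\<^sup>2" if "\<omega> \<in> space M" for \<omega>
      unfolding u_def using grad_G that by (intro average_norm_sq_centred_le m_pos avg_grad_eq)
  qed
  finally have "real (b t) / real m * (\<Sum>i\<in>{1..m}. expectation (\<lambda>\<omega>. (norm (u i \<omega>))\<^sup>2))
      \<le> real (b t) / real m * (real m * G\<^sup>2)"
    by (intro mult_left_mono) auto
  then have "expectation (\<lambda>\<omega>. (norm (\<Sum>j\<in>{1..b t}. u (I t j \<omega>) \<omega>))\<^sup>2) \<le> real (b t) * G\<^sup>2"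
    using expectation_norm_sq_centred_sample_sum[OF F u_meas u_bound u_centred I_M
        sample_uniform[OF t] sample_indep[OF t] sample_indep_past[OF t]] m_pos by simp
  then show "expectation (\<lambda>\<omega>. (err \<omega>)\<^sup>2) \<le> (grad_bound m f C)\<^sup>2 / real (b t)"
    using b_pos[of t] unfolding err_eq power_divide G_def[symmetric]
    by (simp add: field_simps power2_eq_square)
  have x_M: "x t \<in> borel_measurable M" using measurable_from_subalg[OF F x_F] .
  have "stoch_grad t \<in> borel_measurable M"
    unfolding stoch_grad_def[abs_def] by (rule borel_measurable_batch_grad[OF f_smooth I_M x_M])
  moreover have "(\<lambda>\<omega>. grad (avg_fun m f) (x t \<omega>)) \<in> borel_measurable M"
    by (intro measurable_compose[OF x_M] borel_measurable_continuous_onI continuous_on_avg_grad)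
  ultimately show "err \<in> borel_measurable M"
    unfolding err_def by measurable
  show "err \<omega> \<le> 2 * grad_bound m f C" if \<omega>: "\<omega> \<in> space M" for \<omega>
  proof -
    have "norm (stoch_grad t \<omega>) \<le> G"
      unfolding stoch_grad_def batch_grad_def
      using grad_G[OF I_in \<omega>] \<omega> by (intro norm_average_le b_pos) auto
    with avg_G[OF \<omega>] show ?thesis
      using norm_triangle_ineq4[of "stoch_grad t \<omega>" "grad (avg_fun m f) (x t \<omega>)"]
      unfolding err_def G_def by simp
  qed
qed

lemma norm_avg_grad_diff_le:
  assumes "p \<in> C" "q \<in> C"
  shows "norm (grad (avg_fun m f) q - grad (avg_fun m f) p) \<le> smooth_const m f C * norm (q - p)"
proof -
  have eq: "grad (avg_fun m f) q - grad (avg_fun m f) p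
      = (1 / real m) *\<^sub>R (\<Sum>i\<in>{1..m}. grad (f i) q - grad (f i) p)"
    by (simp add: avg_grad_eq sum_subtractf scaleR_diff_right)
  show ?thesis
    unfolding eq
    by (intro norm_average_le m_pos norm_grad_diff_le_smooth_const f_smooth assms)
qed

lemma avg_fun_above_tangent:
  assumes "\<And>i. i \<in> {1..m} \<Longrightarrow> convex_on UNIV (f i)"
  shows "avg_fun m f q \<ge> avg_fun m f p + grad (avg_fun m f) p \<bullet> (q - p)"
proof -
  have "(\<Sum>i\<in>{1..m}. f i p + grad (f i) p \<bullet> (q - p)) \<le> (\<Sum>i\<in>{1..m}. f i q)"
    using assms f_smooth
    by (intro sum_mono convex_on_above_tangent_GDERIV smooth_fun_GDERIV) auto
  then have "(\<Sum>i\<in>{1..m}. f i p + grad (f i) p \<bullet> (q - p)) / real m \<le> (\<Sum>i\<in>{1..m}. f i q) / real m"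
    by (rule divide_right_mono) simp
  then show ?thesis
    by (simp add: avg_fun_def avg_grad_eq sum.distrib inner_sum_left add_divide_distrib)
qed

text \<open>The factor \<open>real K + 1\<close> collects two uses of the gradient error: against
  the displacement of the iterate, of length at most \<open>real K * \<gamma> t * D\<close>, and
  against the direction to \<open>w\<close>, of length at most \<open>D\<close> and weighted by
  \<open>\<gamma> t\<close>.\<close>

lemma progress:
  assumes t: "t < T" and \<omega>: "\<omega> \<in> space M" and w: "w \<in> C"
    and cvx: "\<And>i. i \<in> {1..m} \<Longrightarrow> convex_on UNIV (f i)"
    and L: "0 < L" "L = smooth_const m f C" and \<eta>: "\<eta> t = lm t / L" and D: "D = diameter C"
  shows "avg_fun m f (x (Suc t) \<omega>) \<le> (1 - \<gamma> t) * avg_fun m f (x t \<omega>) + \<gamma> t * avg_fun m f w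
    + \<gamma> t * D * (real K + 1) * norm (stoch_grad t \<omega> - grad (avg_fun m f) (x t \<omega>))
    + (\<gamma> t)\<^sup>2 * L * (lp t / lm t) * D\<^sup>2 / 2"
proof -
  define X where "X = x t \<omega>"
  define X' where "X' = x (Suc t) \<omega>"
  define g where "g = stoch_grad t \<omega>"
  define F where "F = grad (avg_fun m f) X"
  define N where "N = (mat_norm (H t \<omega>) (X' - X))\<^sup>2"
  have \<gamma>: "0 \<le> \<gamma> t" using gamma_range[of t] by auto
  have X: "X \<in> C" unfolding X_def using t \<omega> by (intro x_in_C) auto
  note loop = inner_loop[OF t \<omega> X[unfolded X_def], folded X_def X'_def g_def D]
  have lm: "0 < lm t" by (rule bounds(1))
  have "avg_fun m f X' \<le> avg_fun m f X + F \<bullet> (X' - X) + L / 2 * (norm (X' - X))\<^sup>2"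
    unfolding F_def L(2) by (rule descent_lemma[OF convex_C GDERIV_avg norm_avg_grad_diff_le X loop(1)])
  \<comment> \<open>Here the learning rate is decisive: \<open>1 / \<eta> t = L / lm t\<close>, and
    the diagonal entries are at least \<open>lm t\<close>, so the model's quadratic term dominates
    the smoothness term.\<close>
  moreover have "L / 2 * (norm (X' - X))\<^sup>2 \<le> (1 / (2 * \<eta> t)) * N"
    using mat_norm_sq_bounds(1)[OF H_diag[OF t \<omega>], of "X' - X"] lm L(1) unfolding \<eta> N_def
    by (simp add: field_simps)
  moreover have "model t \<omega> X' = avg_fun m f X + g \<bullet> (X' - X) + (1 / (2 * \<eta> t)) * N"
    by (simp add: model_def quad_model_def X_def g_def N_def)
  moreover have "(F - g) \<bullet> (X' - X) \<le> norm (g - F) * (real K * \<gamma> t * D)"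
  proof -
    have "(F - g) \<bullet> (X' - X) \<le> norm (F - g) * norm (X' - X)"
      by (rule norm_cauchy_schwarz)
    also have "\<dots> \<le> norm (F - g) * (real K * \<gamma> t * D)"
      using loop(2) by (rule mult_left_mono) simp
    finally show ?thesis by (simp add: norm_minus_commute)
  qed
  moreover have "model t \<omega> X' \<le> avg_fun m f X + \<gamma> t * (g \<bullet> (w - X))
      + (\<gamma> t)\<^sup>2 / (2 * \<eta> t) * (lp t * D\<^sup>2)"
    by (rule loop(3)[OF w])
  \<comment> \<open>The sampled gradient is exchanged for the true one, and convexity turns the
    linear term into a difference of objective values.\<close>
  moreover have "\<gamma> t * (g \<bullet> (w - X)) \<le> \<gamma> t * (avg_fun m f w - avg_fun m f X + norm (g - F) * D)"
  proof (rule mult_left_mono[OF _ \<gamma>])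
    have "(g - F) \<bullet> (w - X) \<le> norm (g - F) * norm (w - X)"
      by (rule norm_cauchy_schwarz)
    also have "\<dots> \<le> norm (g - F) * D"
      unfolding D by (intro mult_left_mono dist_C w X) simp
    finally show "g \<bullet> (w - X) \<le> avg_fun m f w - avg_fun m f X + norm (g - F) * D"
      using avg_fun_above_tangent[OF cvx, where p = X and q = w] unfolding F_def[symmetric]
      by (simp add: inner_diff_left)
  qed
  moreover have "(\<gamma> t)\<^sup>2 / (2 * \<eta> t) * (lp t * D\<^sup>2) = (\<gamma> t)\<^sup>2 * L * (lp t / lm t) * D\<^sup>2 / 2"
    using lm L(1) by (simp add: \<eta>)
  ultimately have "avg_fun m f X' \<le> avg_fun m f X + norm (g - F) * (real K * \<gamma> t * D)
      + \<gamma> t * (avg_fun m f w - avg_fun m f X + norm (g - F) * D)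
      + (\<gamma> t)\<^sup>2 * L * (lp t / lm t) * D\<^sup>2 / 2"
    by (simp add: inner_diff_left)
  then show ?thesis
    unfolding X_def[symmetric] X'_def[symmetric] g_def[symmetric] F_def[symmetric]
    by (simp add: algebra_simps)
qed

text \<open>The intervals for the diagonal entries are nested, so the ratio of their ends is largest
  at the start.\<close>

lemma condition_number_le: "lp t / lm t \<le> lp 0 / lm 0"
proof -
  have "lm 0 \<le> lm t" "lp t \<le> lp 0"
    using lift_Suc_mono_le[of lm 0 t] lift_Suc_antimono_le[of lp 0 t] bounds by auto
  then show ?thesis
    using bounds(1)[of 0] bounds(1)[of t] lp_pos[of t] by (intro frac_le) auto
qed

lemma integrable_avg_fun_x:
  assumes "t \<le> T"
  shows "integrable M (\<lambda>\<omega>. avg_fun m f (x t \<omega>))"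
proof -
  obtain B where "\<And>z. z \<in> C \<Longrightarrow> norm (avg_fun m f z) \<le> B"
    using compact_imp_bounded[OF compact_continuous_image[OF continuous_on_avg_fun C_problem(1)]]
    unfolding bounded_iff by auto
  moreover have "(\<lambda>\<omega>. avg_fun m f (x t \<omega>)) \<in> borel_measurable M"
    using measurable_from_subalg[OF history(1) x_measurable] assms
    by (intro measurable_compose[OF _ borel_measurable_continuous_onI[OF continuous_on_avg_fun]])
  ultimately show ?thesis
    using x_in_C[OF assms] by (intro integrable_const_bound[where B = B] AE_I2) auto
qed

text \<open>The batch size is tied to a target accuracy \<open>\<sigma>\<close>: the hypothesis
  brings the mean square error below its square, and this controls the first moment.\<close>

lemma expectation_grad_error_le:
  assumes t: "t < T" and \<sigma>: "0 < \<sigma>" and b: "(grad_bound m f C / \<sigma>)\<^sup>2 \<le> real (b t)"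
  defines "err \<equiv> \<lambda>\<omega>. norm (stoch_grad t \<omega> - grad (avg_fun m f) (x t \<omega>))"
  shows "integrable M err" "expectation err \<le> \<sigma>"
proof -
  have err: "err \<in> borel_measurable M"
    "\<And>\<omega>. \<omega> \<in> space M \<Longrightarrow> err \<omega> \<le> 2 * grad_bound m f C"
    "expectation (\<lambda>\<omega>. (err \<omega>)\<^sup>2) \<le> (grad_bound m f C)\<^sup>2 / real (b t)"
    unfolding err_def by (rule expectation_grad_error_sq[OF t], assumption?)+
  have err0: "0 \<le> err \<omega>" for \<omega> by (simp add: err_def)
  show int: "integrable M err"
    using err(1,2) err0 by (intro integrable_const_bound[where B = "2 * grad_bound m f C"] AE_I2) auto
  have int2: "integrable M (\<lambda>\<omega>. (err \<omega>)\<^sup>2)"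
    using err(1) power_mono[OF err(2) err0, of _ 2]
    by (intro integrable_const_bound[where B = "(2 * grad_bound m f C)\<^sup>2"] AE_I2) auto
  have "(grad_bound m f C)\<^sup>2 / real (b t) \<le> \<sigma>\<^sup>2"
    using b \<sigma> b_pos[of t] by (simp add: power_divide field_simps)
  with err(3) have sq: "expectation (\<lambda>\<omega>. (err \<omega>)\<^sup>2) \<le> \<sigma>\<^sup>2" by simp
  \<comment> \<open>AM-GM in place of Jensen's inequality\<close>
  have "err \<omega> \<le> (\<sigma> + (err \<omega>)\<^sup>2 / \<sigma>) / 2" for \<omega>
  proof -
    have "0 \<le> (err \<omega> - \<sigma>)\<^sup>2" by simp
    then show ?thesis using \<sigma> by (simp add: power2_eq_square field_simps)
  qed
  then have "expectation err \<le> expectation (\<lambda>\<omega>. (\<sigma> + (err \<omega>)\<^sup>2 / \<sigma>) / 2)"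
    using int int2 by (intro integral_mono) auto
  also have "\<dots> = (\<sigma> + expectation (\<lambda>\<omega>. (err \<omega>)\<^sup>2) / \<sigma>) / 2"
    using int2 by (simp add: prob_space)
  also have "\<dots> \<le> (\<sigma> + \<sigma>\<^sup>2 / \<sigma>) / 2"
    using sq \<sigma> by (intro divide_right_mono add_left_mono) auto
  finally show "expectation err \<le> \<sigma>"
    using \<sigma> by (simp add: power2_eq_square)
qed

end

section \<open>Convergence rate\<close>

text \<open>The step from \<open>t\<close> to \<open>t + 1\<close> works because
  \<open>r / (r + 1) + 1 / (r + 2) \<le> 1\<close>. No bound on the initial gap enters: its
  coefficient at index 0 is zero.\<close>

lemma fw_recursion_bound:
  fixes \<epsilon> :: "nat \<Rightarrow> real"
  assumes rec: "\<And>t. t < T \<Longrightarrow> \<epsilon> (Suc t) \<le> (1 - 2 / (real t + 2)) * \<epsilon> t + 2 * A / (real t + 2)\<^sup>2"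
    and A: "0 \<le> A" and t: "1 \<le> t" "t \<le> T"
  shows "\<epsilon> t \<le> 2 * A / (real t + 1)"
  using t
proof (induction t rule: dec_induct)
  case base
  \<comment> \<open>At index 0 the factor \<open>1 - 2 / 2\<close> removes the initial gap and
    leaves \<open>A / 2\<close>, below the claimed \<open>A\<close>.\<close>
  then show ?case using rec[of 0] A by (simp add: power2_eq_square)
next
  case (step t)
  define r where "r = real t"
  have r: "1 \<le> r" using step by (simp add: r_def)
  have "\<epsilon> (Suc t) \<le> (1 - 2 / (r + 2)) * \<epsilon> t + 2 * A / (r + 2)\<^sup>2"
    using rec[of t] step by (simp add: r_def)
  also have "\<dots> \<le> (1 - 2 / (r + 2)) * (2 * A / (r + 1)) + 2 * A / (r + 2)\<^sup>2"
    using step r by (intro add_right_mono mult_left_mono) (auto simp: r_def)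
  also have "\<dots> = 2 * A / (r + 2) * (r / (r + 1) + 1 / (r + 2))"
    using r by (simp add: divide_simps power2_eq_square) (simp add: algebra_simps)
  also have "\<dots> \<le> 2 * A / (r + 2) * 1"
  proof (intro mult_left_mono)
    have "1 / (r + 2) \<le> 1 / (r + 1)" using r by (intro divide_left_mono) auto
    moreover have "r / (r + 1) = 1 - 1 / (r + 1)" using r by (simp add: field_simps)
    ultimately show "r / (r + 1) + 1 / (r + 2) \<le> 1" by simp
  qed (use r A in auto)
  finally show ?case by (simp add: r_def add.commute)
qed

theorem theorem3p1:
  fixes M :: "'w measure"
    and C :: "(real ^ 'n) set"
    and m T K :: nat
    and f :: "nat \<Rightarrow> real ^ 'n \<Rightarrow> real"
    and x0 :: "real ^ 'n"
    and b :: "nat \<Rightarrow> nat"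
    and lm lp \<eta> \<gamma> :: "nat \<Rightarrow> real"
    and past mid :: "nat \<Rightarrow> 'w measure"
    and I :: "nat \<Rightarrow> nat \<Rightarrow> 'w \<Rightarrow> nat"
    and H :: "nat \<Rightarrow> 'w \<Rightarrow> real ^ 'n ^ 'n"
    and x :: "nat \<Rightarrow> 'w \<Rightarrow> real ^ 'n"
    and y v :: "nat \<Rightarrow> nat \<Rightarrow> 'w \<Rightarrow> real ^ 'n"
    and D G L \<kappa> :: real
  assumes alg: "AdaSFW M C m f T K x0 b lm lp \<eta> \<gamma> past mid I H x y v"
    and D_def: "D = diameter C" and D_pos: "D > 0"
    and G_def: "G = grad_bound m f C" and G_pos: "G > 0"
    and L_def: "L = smooth_const m f C" and L_pos: "L > 0"
    and f_convex: "\<And>i. i \<in> {1..m} \<Longrightarrow> convex_on UNIV (f i)"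
    and batch: "\<And>t. b t = nat \<lceil>(G * (real t + 2) / (L * D))\<^sup>2\<rceil>"
    and rate: "\<And>t. \<eta> t = lm t / L"
    and step: "\<And>t. \<gamma> t = 2 / (real t + 2)"
    and kappa: "\<kappa> = lp 0 / lm 0"
  shows "\<forall>t\<in>{1..T}.
    (\<integral>\<omega>. avg_fun m f (x t \<omega>) \<partial>M) - (INF z\<in>C. avg_fun m f z)
      \<le> 2 * L * D\<^sup>2 * (real K + 1 + \<kappa>) / (real t + 1)"
proof -
  interpret AdaSFW M C m f T K x0 b lm lp \<eta> \<gamma> past mid I H x y v by (rule alg)
  define A where "A = L * D\<^sup>2 * (real K + 1 + \<kappa>)"
  \<comment> \<open>The minimum is attained by compactness, so the infimum becomes the value at a
    fixed comparison point for \<open>progress\<close>.\<close>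
  obtain w where w: "w \<in> C" and w_min: "\<And>z. z \<in> C \<Longrightarrow> avg_fun m f w \<le> avg_fun m f z"
    using continuous_attains_inf[OF C_problem(1,3) continuous_on_avg_fun] by blast
  have inf: "(INF z\<in>C. avg_fun m f z) = avg_fun m f w"
    using w w_min by (intro cInf_eq_minimum) auto
  define \<epsilon> where "\<epsilon> t = expectation (\<lambda>\<omega>. avg_fun m f (x t \<omega>)) - avg_fun m f w" for t
  have \<kappa>: "0 < \<kappa>" using lp_pos bounds(1) by (simp add: kappa)
  have rec: "\<epsilon> (Suc t) \<le> (1 - 2 / (real t + 2)) * \<epsilon> t + 2 * A / (real t + 2)\<^sup>2" if t: "t < T" for t
  proof -
    define r where "r = real t + 2"
    have r: "0 < r" by (simp add: r_def)
    define err where "err \<omega> = norm (stoch_grad t \<omega> - grad (avg_fun m f) (x t \<omega>))" for \<omega>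
    \<comment> \<open>Chosen so that the square of \<open>G / \<sigma>\<close> is exactly the number
      rounded up in the batch size.\<close>
    define \<sigma> where "\<sigma> = L * D / r"
    have \<sigma>: "0 < \<sigma>" using L_pos D_pos r by (simp add: \<sigma>_def)
    have "(grad_bound m f C / \<sigma>)\<^sup>2 \<le> real (b t)"
      using of_nat_ceiling[of "(G * (real t + 2) / (L * D))\<^sup>2"]
      unfolding batch \<sigma>_def r_def G_def[symmetric] by simp
    note err = expectation_grad_error_le[OF t \<sigma> this, folded err_def]
    note int = integrable_avg_fun_x[of t] integrable_avg_fun_x[of "Suc t"]
    have gam: "\<gamma> t = 2 / r" by (simp add: step r_def)
    have "expectation (\<lambda>\<omega>. avg_fun m f (x (Suc t) \<omega>))
      \<le> expectation (\<lambda>\<omega>. (1 - \<gamma> t) * avg_fun m f (x t \<omega>) + \<gamma> t * avg_fun m f w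
          + \<gamma> t * D * (real K + 1) * err \<omega> + (\<gamma> t)\<^sup>2 * L * (lp t / lm t) * D\<^sup>2 / 2)"
      unfolding err_def using t int err(1)[unfolded err_def]
      by (intro integral_mono progress[OF t _ w f_convex L_pos L_def rate D_def]) auto
    also have "\<dots> = (1 - \<gamma> t) * expectation (\<lambda>\<omega>. avg_fun m f (x t \<omega>)) + \<gamma> t * avg_fun m f w
        + \<gamma> t * D * (real K + 1) * expectation err + (\<gamma> t)\<^sup>2 * L * (lp t / lm t) * D\<^sup>2 / 2"
      using t int err(1) by (simp add: prob_space)
    also have "\<dots> \<le> (1 - \<gamma> t) * expectation (\<lambda>\<omega>. avg_fun m f (x t \<omega>)) + \<gamma> t * avg_fun m f w
        + \<gamma> t * D * (real K + 1) * \<sigma> + (\<gamma> t)\<^sup>2 * L * \<kappa> * D\<^sup>2 / 2"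
      unfolding kappa using err(2) condition_number_le[of t] D_pos L_pos r
      by (intro add_mono order_refl mult_left_mono divide_right_mono mult_right_mono) (auto simp: gam)
    \<comment> \<open>With \<open>\<gamma> t = 2 / r\<close>, the noise gives
      \<open>2 * L * D\<^sup>2 * (real K + 1) / r\<^sup>2\<close> and the curvature
      \<open>2 * L * D\<^sup>2 * \<kappa> / r\<^sup>2\<close>; together these are
      \<open>2 * A / r\<^sup>2\<close>.\<close>
    also have "\<dots> = avg_fun m f w + (1 - 2 / r) * \<epsilon> t + 2 * A / r\<^sup>2"
      unfolding gam \<epsilon>_def \<sigma>_def A_def using r
      by (simp add: field_simps power2_eq_square)
    finally show ?thesis
      unfolding r_def \<epsilon>_def by simp
  qed
  show ?thesis
  proof
    fix t assume "t \<in> {1..T}"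
    then have "\<epsilon> t \<le> 2 * A / (real t + 1)"
      using rec L_pos \<kappa> by (intro fw_recursion_bound[where T = T]) (auto simp: A_def)
    then show "expectation (\<lambda>\<omega>. avg_fun m f (x t \<omega>)) - (INF z\<in>C. avg_fun m f z)
        \<le> 2 * L * D\<^sup>2 * (real K + 1 + \<kappa>) / (real t + 1)"
      by (simp add: \<epsilon>_def A_def inf mult.assoc)
  qed
qed

end
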